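(* Let $M$ be a connected orientable smooth manifold of dimension $2n\ge 4$ and let $f\colon M\to\mathbb{R}^{2n+1}$ be a non-degenerate affine hypersurface with a locally equiaffine transversal vector field $\xi$ and an almost symplectic form $\omega$ on $M$. Suppose $R^p\omega=0$ for some $p\ge 1$. Let $x\in M$ and let $S=S_1\oplus\cdots\oplus S_q\oplus S_{q+1}\oplus\cdots\oplus S_{q+r}$, $h=H_1\oplus\cdots\oplus H_{q+r}$ be a simultaneous Jordan decomposition (as defined in the context) of the shape operator $S$ and the second fundamental form $h$ at $x$, where $S_1,\ldots,S_q$ are the real Jordan blocks and $S_{q+1},\ldots,S_{q+r}$ the complex Jordan blocks. Then the decomposition contains no complex Jordan blocks, that is, $r=0$.
   Context: Affine hypersurfaces: for an immersion $f\colon M\to\mathbb{R}^{2n+1}$, $\dim M=2n$, with a transversal vector field $\xi$ and the standard flat connection $\mathrm{D}$, the formulas $\mathrm{D}_Xf_*Y=f_*(\nabla_XY)+h(X,Y)\xi$ and $\mathrm{D}_X\xi=-f_*(SX)+\tau(X)\xi$ define the induced torsion-free connection $\nabla$, the second fundamental form $h$ (symmetric), the shape operator $S$ and the $1$-form $\tau$. The curvature $R$ of $\nabla$ satisfies $R(X,Y)Z=h(Y,Z)SX-h(X,Z)SY$. Non-degenerate means $h$ is non-degenerate; $\xi$ is locally equiaffine if $d\tau=0$ (equivalently $h(SX,Y)=h(X,SY)$). An almost symplectic form is a non-degenerate $2$-form. Powers of $R$: for a $(0,p)$-tensor $T$, $(R\cdot T)(X_1,\ldots,X_{p+2})=-\sum_{i=3}^{p+2}T(X_3,\ldots,R(X_1,X_2)X_i,\ldots,X_{p+2})$;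 $R^0T=T$, $R^kT=R\cdot(R^{k-1}T)$. Simultaneous Jordan decomposition at $x$: a basis $e_1,\ldots,e_{2n}$ of $T_xM$ in which $S=\operatorname{diag}(S_1,\ldots,S_{q+r})$ and $h=\operatorname{diag}(H_1,\ldots,H_{q+r})$ are block diagonal with $\dim S_i=\dim H_i$ and: for $1\le i\le q$, $S_i$ is a real Jordan block, i.e. a $k\times k$ matrix with a real number $\lambda$ on the diagonal, $1$'s directly below the diagonal and zeros elsewhere, with $\dim S_i\ge\dim S_{i+1}$ for $1\le i\le q-1$, and $H_i=\pm P$; for $q+1\le i\le q+r$, $S_i$ is a complex Jordan block, i.e. a $2k\times 2k$ matrix with $2\times2$ blocks $B=\begin{bmatrix}\alpha&\beta\\-\beta&\alpha\end{bmatrix}$ ($\beta\ne 0$) on the block diagonal, $2\times 2$ identity matrices directly below the block diagonal and zeros elsewhere, with $\dim S_i\ge\dim S_{i+1}$ for $q+1\le i\le q+r-1$, and $H_i=P$. Here $P$ is the sip matrix of the appropriate size (1's on the anti-diagonal, zeros elsewhere). Such a basis exists at every point. *)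

theory Defs
  imports
    "HOL-Analysis.Analysis"
    "HOL-Library.Function_Algebras"
    "Jordan_Normal_Form.Matrix"
begin

section \<open>Smooth maps between normed spaces\<close>

primrec Ck_on ::
  "nat \<Rightarrow> 'a::real_normed_vector set \<Rightarrow> ('a \<Rightarrow> 'b::real_normed_vector) \<Rightarrow> bool" where
  "Ck_on 0 U f \<longleftrightarrow> continuous_on U f"
| "Ck_on (Suc k) U f \<longleftrightarrow> (\<forall>x\<in>U. f differentiable at x) \<and>
     (\<forall>v. Ck_on k U (\<lambda>x. frechet_derivative f (at x) v))"

text \<open>Only meant for open \<open>U\<close> in a finite-dimensional space.\<close>
definition smooth_on :: "'a::real_normed_vector set \<Rightarrow> ('a \<Rightarrow> 'b::real_normed_vector) \<Rightarrow> bool" where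
  "smooth_on U f \<longleftrightarrow> (\<forall>k. Ck_on k U f)"


section \<open>Smooth manifolds\<close>

text \<open>A chart is a pair \<open>(U, \<phi>)\<close>; the values of \<open>\<phi>\<close> outside \<open>U\<close> are irrelevant.\<close>
type_synonym ('a, 'm) chart = "'a set \<times> ('a \<Rightarrow> (real, 'm) Finite_Cartesian_Product.vec)"

definition chart_inv :: "('a, 'm::finite) chart \<Rightarrow> real^'m \<Rightarrow> 'a" where
  "chart_inv c = inv_into (fst c) (snd c)"

definition is_chart :: "'a topology \<Rightarrow> ('a, 'm::finite) chart \<Rightarrow> bool" where
  "is_chart M c \<longleftrightarrow> openin M (fst c) \<and> open (snd c ` fst c) \<and>
     homeomorphic_map (subtopology M (fst c)) (top_of_set (snd c ` fst c)) (snd c)"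

definition smooth_atlas :: "'a topology \<Rightarrow> ('a, 'm::finite) chart set \<Rightarrow> bool" where
  "smooth_atlas M A \<longleftrightarrow> (\<forall>c\<in>A. is_chart M c) \<and> (\<Union>c\<in>A. fst c) = topspace M \<and>
     (\<forall>c\<in>A. \<forall>d\<in>A. smooth_on (snd c ` (fst c \<inter> fst d)) (snd d \<circ> chart_inv c))"

definition smooth_manifold :: "'a topology \<Rightarrow> ('a, 'm::finite) chart set \<Rightarrow> bool" where
  "smooth_manifold M A \<longleftrightarrow> Hausdorff_space M \<and> second_countable M \<and> smooth_atlas M A"

text \<open>The orienting atlas \<open>B\<close> may differ from \<open>A\<close>, but must define the same smooth structure.\<close>
definition orientable :: "'a topology \<Rightarrow> ('a, 'm::finite) chart set \<Rightarrow> bool" where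
  "orientable M A \<longleftrightarrow> (\<exists>B. smooth_atlas M B \<and> smooth_atlas M (A \<union> B) \<and>
     (\<forall>c\<in>B. \<forall>d\<in>B. \<forall>q \<in> snd c ` (fst c \<inter> fst d).
        det (matrix (frechet_derivative (snd d \<circ> chart_inv c) (at q))) > 0))"

definition charts_at :: "('a, 'm::finite) chart set \<Rightarrow> 'a \<Rightarrow> ('a, 'm) chart set" where
  "charts_at A x = {c \<in> A. x \<in> fst c}"

definition smooth_map_on ::
  "('a, 'm::finite) chart set \<Rightarrow> 'a set \<Rightarrow> ('a \<Rightarrow> 'b::real_normed_vector) \<Rightarrow> bool" where
  "smooth_map_on A U F \<longleftrightarrow> (\<forall>c\<in>A. smooth_on (snd c ` (fst c \<inter> U)) (F \<circ> chart_inv c))"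


section \<open>Tangent vectors and vector fields\<close>

instantiation "fun" :: (type, scaleR) scaleR
begin
definition scaleR_fun_def: "r *\<^sub>R f = (\<lambda>x. r *\<^sub>R f x)"
instance ..
end

instance "fun" :: (type, real_vector) real_vector
  by standard (simp_all add: scaleR_fun_def fun_eq_iff scaleR_add_right scaleR_add_left)

text \<open>
  A tangent vector at \<open>x\<close> is a family of coordinate vectors, one for each chart around \<open>x\<close>,
  related by the Jacobians of the transition maps. It is extended by zero to all other charts,
  so that the tangent space is a linear subspace of a function space.
\<close>
type_synonym ('a, 'm) tvec = "('a, 'm) chart \<Rightarrow> (real, 'm) Finite_Cartesian_Product.vec"
type_synonym ('a, 'm) vfield = "'a \<Rightarrow> ('a, 'm) tvec"

definition tangent_space :: "('a, 'm::finite) chart set \<Rightarrow> 'a \<Rightarrow> ('a, 'm) tvec set" where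
  "tangent_space A x = {v.
     (\<forall>c\<in>charts_at A x. \<forall>d\<in>charts_at A x.
        v d = frechet_derivative (snd d \<circ> chart_inv c) (at (snd c x)) (v c)) \<and>
     (\<forall>c. c \<notin> charts_at A x \<longrightarrow> v c = 0)}"

text \<open>
  Derivative of a vector-valued function \<open>F\<close> at \<open>x\<close> along \<open>v\<close>; it does not depend on the
  chart. For \<open>F = f\<close> this is the push-forward of \<open>v\<close>, and for a vector field \<open>F\<close> along an
  immersion into a Euclidean space it is the standard flat connection.
\<close>
definition tan_deriv ::
  "('a, 'm::finite) chart set \<Rightarrow> ('a \<Rightarrow> 'b::real_normed_vector) \<Rightarrow> 'a \<Rightarrow> ('a, 'm) tvec \<Rightarrow> 'b" where
  "tan_deriv A F x v = (let c = (SOME c. c \<in> charts_at A x) in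
     frechet_derivative (F \<circ> chart_inv c) (at (snd c x)) (v c))"

definition vector_fields ::
  "('a, 'm::finite) chart set \<Rightarrow> 'a set \<Rightarrow> ('a, 'm) vfield set" where
  "vector_fields A U = {X. (\<forall>x\<in>U. X x \<in> tangent_space A x) \<and>
     (\<forall>c\<in>A. smooth_on (snd c ` (fst c \<inter> U)) (\<lambda>q. X (chart_inv c q) c))}"

definition lie_bracket ::
  "('a, 'm::finite) chart set \<Rightarrow> ('a, 'm) vfield \<Rightarrow> ('a, 'm) vfield \<Rightarrow> ('a, 'm) vfield" where
  "lie_bracket A X Y = (\<lambda>x c. if c \<in> charts_at A x
     then frechet_derivative (\<lambda>q. Y (chart_inv c q) c) (at (snd c x)) (X x c)
        - frechet_derivative (\<lambda>q. X (chart_inv c q) c) (at (snd c x)) (Y x c)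
     else 0)"


section \<open>Tensors and differential forms\<close>

definition bilinear_at ::
  "('a, 'm::finite) chart set \<Rightarrow> 'a \<Rightarrow> (('a, 'm) tvec \<Rightarrow> ('a, 'm) tvec \<Rightarrow> real) \<Rightarrow> bool" where
  "bilinear_at A x b \<longleftrightarrow>
     (\<forall>u\<in>tangent_space A x. \<forall>v\<in>tangent_space A x. \<forall>w\<in>tangent_space A x. \<forall>a.
        b (u + v) w = b u w + b v w \<and> b (a *\<^sub>R u) w = a * b u w \<and>
        b w (u + v) = b w u + b w v \<and> b w (a *\<^sub>R u) = a * b w u)"

definition nondegenerate_at ::
  "('a, 'm::finite) chart set \<Rightarrow> 'a \<Rightarrow> (('a, 'm) tvec \<Rightarrow> ('a, 'm) tvec \<Rightarrow> real) \<Rightarrow> bool" where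
  "nondegenerate_at A x b \<longleftrightarrow>
     (\<forall>u\<in>tangent_space A x. (\<forall>v\<in>tangent_space A x. b u v = 0) \<longrightarrow> u = 0)"

definition two_form ::
  "'a topology \<Rightarrow> ('a, 'm::finite) chart set \<Rightarrow>
   ('a \<Rightarrow> ('a, 'm) tvec \<Rightarrow> ('a, 'm) tvec \<Rightarrow> real) \<Rightarrow> bool" where
  "two_form M A \<omega> \<longleftrightarrow>
     (\<forall>x\<in>topspace M. bilinear_at A x (\<omega> x) \<and> (\<forall>u\<in>tangent_space A x. \<omega> x u u = 0)) \<and>
     (\<forall>U X Y. openin M U \<and> X \<in> vector_fields A U \<and> Y \<in> vector_fields A U \<longrightarrow>
        smooth_map_on A U (\<lambda>x. \<omega> x (X x) (Y x)))"

definition almost_symplectic ::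
  "'a topology \<Rightarrow> ('a, 'm::finite) chart set \<Rightarrow>
   ('a \<Rightarrow> ('a, 'm) tvec \<Rightarrow> ('a, 'm) tvec \<Rightarrow> real) \<Rightarrow> bool" where
  "almost_symplectic M A \<omega> \<longleftrightarrow>
     two_form M A \<omega> \<and> (\<forall>x\<in>topspace M. nondegenerate_at A x (\<omega> x))"

definition closed_one_form ::
  "'a topology \<Rightarrow> ('a, 'm::finite) chart set \<Rightarrow> ('a \<Rightarrow> ('a, 'm) tvec \<Rightarrow> real) \<Rightarrow> bool" where
  "closed_one_form M A \<tau> \<longleftrightarrow>
     (\<forall>U X Y. openin M U \<and> X \<in> vector_fields A U \<and> Y \<in> vector_fields A U \<longrightarrow>
        (\<forall>x\<in>U. tan_deriv A (\<lambda>y. \<tau> y (Y y)) x (X x) - tan_deriv A (\<lambda>y. \<tau> y (X y)) x (Y x)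
               - \<tau> x (lie_bracket A X Y x) = 0))"


section \<open>Affine hypersurfaces\<close>

definition immersion ::
  "'a topology \<Rightarrow> ('a, 'm::finite) chart set \<Rightarrow> ('a \<Rightarrow> 'b::real_normed_vector) \<Rightarrow> bool" where
  "immersion M A f \<longleftrightarrow> smooth_map_on A (topspace M) f \<and>
     (\<forall>x\<in>topspace M. inj_on (tan_deriv A f x) (tangent_space A x))"

text \<open>In codimension one, transversality means that \<open>\<xi>\<close> is nowhere tangent.\<close>
definition transversal_field ::
  "'a topology \<Rightarrow> ('a, 'm::finite) chart set \<Rightarrow> ('a \<Rightarrow> 'b::real_normed_vector) \<Rightarrow> ('a \<Rightarrow> 'b) \<Rightarrow> bool" where
  "transversal_field M A f \<xi> \<longleftrightarrow> smooth_map_on A (topspace M) \<xi> \<and>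
     (\<forall>x\<in>topspace M. \<xi> x \<notin> tan_deriv A f x ` tangent_space A x)"

text \<open>
  The formulas of Gauss and Weingarten for all local vector fields \<open>X\<close>, \<open>Y\<close>. Given an
  immersion \<open>f\<close> of codimension one and a transversal field \<open>\<xi>\<close>, they have a solution, which is
  unique on \<open>M\<close>, its tangent vectors and its local vector fields. Vector fields are
  total functions, but \<open>nab X Y\<close> is constrained only on open sets where
  \<open>X\<close> and \<open>Y\<close> are smooth.
\<close>
definition induced_by ::
  "'a topology \<Rightarrow> ('a, 'm::finite) chart set \<Rightarrow> ('a \<Rightarrow> 'b::real_normed_vector) \<Rightarrow> ('a \<Rightarrow> 'b) \<Rightarrow>
   (('a, 'm) vfield \<Rightarrow> ('a, 'm) vfield \<Rightarrow> ('a, 'm) vfield) \<Rightarrow>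
   ('a \<Rightarrow> ('a, 'm) tvec \<Rightarrow> ('a, 'm) tvec \<Rightarrow> real) \<Rightarrow>
   ('a \<Rightarrow> ('a, 'm) tvec \<Rightarrow> ('a, 'm) tvec) \<Rightarrow>
   ('a \<Rightarrow> ('a, 'm) tvec \<Rightarrow> real) \<Rightarrow> bool" where
  "induced_by M A f \<xi> nab h S \<tau> \<longleftrightarrow>
     (\<forall>x\<in>topspace M. \<forall>v\<in>tangent_space A x. S x v \<in> tangent_space A x) \<and>
     (\<forall>U X Y. openin M U \<and> X \<in> vector_fields A U \<and> Y \<in> vector_fields A U \<longrightarrow>
        nab X Y \<in> vector_fields A U \<and>
        (\<forall>x\<in>U.
           tan_deriv A (\<lambda>y. tan_deriv A f y (Y y)) x (X x)
             = tan_deriv A f x (nab X Y x) + h x (X x) (Y x) *\<^sub>R \<xi> x \<and>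
           tan_deriv A \<xi> x (X x)
             = - tan_deriv A f x (S x (X x)) + \<tau> x (X x) *\<^sub>R \<xi> x))"

definition curvature_of ::
  "'a topology \<Rightarrow> ('a, 'm::finite) chart set \<Rightarrow>
   (('a, 'm) vfield \<Rightarrow> ('a, 'm) vfield \<Rightarrow> ('a, 'm) vfield) \<Rightarrow>
   ('a \<Rightarrow> ('a, 'm) tvec \<Rightarrow> ('a, 'm) tvec \<Rightarrow> ('a, 'm) tvec \<Rightarrow> ('a, 'm) tvec) \<Rightarrow> bool" where
  "curvature_of M A nab R \<longleftrightarrow>
     (\<forall>U X Y Z. openin M U \<and> X \<in> vector_fields A U \<and> Y \<in> vector_fields A U \<and>
                Z \<in> vector_fields A U \<longrightarrow>
        (\<forall>x\<in>U. R x (X x) (Y x) (Z x)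
             = nab X (nab Y Z) x - nab Y (nab X Z) x - nab (lie_bracket A X Y) Z x))"

text \<open>
  A \<open>(0,p)\<close>-tensor field sends a point and a list of \<open>p\<close> tangent vectors to a number;
  the type does not record \<open>p\<close>.
\<close>
type_synonym ('a, 'm) tensor = "'a \<Rightarrow> ('a, 'm) tvec list \<Rightarrow> real"

definition curvature_action ::
  "('a \<Rightarrow> ('a, 'm::finite) tvec \<Rightarrow> ('a, 'm) tvec \<Rightarrow> ('a, 'm) tvec \<Rightarrow> ('a, 'm) tvec) \<Rightarrow>
   ('a, 'm) tensor \<Rightarrow> ('a, 'm) tensor" where
  "curvature_action R T = (\<lambda>x vs. - (\<Sum>i<length vs - 2.
     T x ((drop 2 vs)[i := R x (vs ! 0) (vs ! 1) (vs ! (i + 2))])))"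

definition form_tensor ::
  "('a \<Rightarrow> ('a, 'm::finite) tvec \<Rightarrow> ('a, 'm) tvec \<Rightarrow> real) \<Rightarrow> ('a, 'm) tensor" where
  "form_tensor \<omega> = (\<lambda>x vs. \<omega> x (vs ! 0) (vs ! 1))"

definition tensor_vanishes ::
  "'a topology \<Rightarrow> ('a, 'm::finite) chart set \<Rightarrow> nat \<Rightarrow> ('a, 'm) tensor \<Rightarrow> bool" where
  "tensor_vanishes M A p T \<longleftrightarrow> (\<forall>x\<in>topspace M. \<forall>vs.
     length vs = p \<and> set vs \<subseteq> tangent_space A x \<longrightarrow> T x vs = 0)"


section \<open>Simultaneous Jordan decomposition\<close>

text \<open>Rows and columns of all matrices are numbered from 0.\<close>

definition real_jordan_block :: "nat \<Rightarrow> real \<Rightarrow> real mat" where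
  "real_jordan_block k a = Matrix.mat k k (\<lambda>(i, j).
     if i = j then a else if i = j + 1 then 1 else 0)"

definition complex_jordan_block :: "nat \<Rightarrow> real \<Rightarrow> real \<Rightarrow> real mat" where
  "complex_jordan_block k \<alpha> \<beta> = Matrix.mat (2 * k) (2 * k) (\<lambda>(i, j).
     if i div 2 = j div 2 then (if i = j then \<alpha> else if i < j then \<beta> else - \<beta>)
     else if i = j + 2 then 1 else 0)"

definition sip_mat :: "nat \<Rightarrow> real mat" where
  "sip_mat k = Matrix.mat k k (\<lambda>(i, j). if i + j + 1 = k then 1 else 0)"

text \<open>The matrix of an endomorphism has the coordinates of the images of the basis as columns.\<close>
definition simultaneous_jordan_decomposition ::
  "'v::real_vector set \<Rightarrow> nat \<Rightarrow> ('v \<Rightarrow> 'v) \<Rightarrow> ('v \<Rightarrow> 'v \<Rightarrow> real) \<Rightarrow>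
   (nat \<Rightarrow> 'v) \<Rightarrow> nat \<Rightarrow> nat \<Rightarrow> real mat list \<Rightarrow> real mat list \<Rightarrow> bool" where
  "simultaneous_jordan_decomposition V d S h e q r Ss Hs \<longleftrightarrow>
     inj_on e {..<d} \<and> independent (e ` {..<d}) \<and> span (e ` {..<d}) = V \<and>
     length Ss = q + r \<and> length Hs = q + r \<and>
     diag_block_mat Ss \<in> carrier_mat d d \<and> diag_block_mat Hs \<in> carrier_mat d d \<and>
     (\<forall>j<d. S (e j) = (\<Sum>i<d. (diag_block_mat Ss $$ (i, j)) *\<^sub>R e i)) \<and>
     (\<forall>i<d. \<forall>j<d. h (e i) (e j) = diag_block_mat Hs $$ (i, j)) \<and>
     (\<forall>i<q. \<exists>k a. k \<ge> 1 \<and> Ss ! i = real_jordan_block k a \<and>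
        (Hs ! i = sip_mat k \<or> Hs ! i = - sip_mat k)) \<and>
     (\<forall>i. q \<le> i \<and> i < q + r \<longrightarrow> (\<exists>k \<alpha> \<beta>. k \<ge> 1 \<and> \<beta> \<noteq> 0 \<and>
        Ss ! i = complex_jordan_block k \<alpha> \<beta> \<and> Hs ! i = sip_mat (2 * k))) \<and>
     (\<forall>i. i + 1 < q \<longrightarrow> dim_row (Ss ! i) \<ge> dim_row (Ss ! (i + 1))) \<and>
     (\<forall>i. q \<le> i \<and> i + 1 < q + r \<longrightarrow> dim_row (Ss ! i) \<ge> dim_row (Ss ! (i + 1)))"

end

theory Submission
  imports Defs
begin

text \<open>
Everything happens at the point \<open>x\<close>. The Gauss equation
  \<open>R(u, v) w = h(v, w) S u - h(u, w) S v\<close> turns the hypothesis on \<open>R\<^sup>p\<omega>\<close> into a statement about a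
  vector space with a symmetric form \<open>h\<close>, an alternating form \<open>\<omega>\<close>, both non-degenerate, and an
  \<open>h\<close>-self-adjoint operator \<open>S\<close>. A complex Jordan block contains an \<open>S\<close>-invariant plane, spanned by its
  last two basis vectors \<open>a\<close>, \<open>b\<close>, on which \<open>S\<close> has the eigenvalues \<open>\<alpha> \<plusminus> i\<beta>\<close> with \<open>\<beta> \<noteq> 0\<close>. The size of
  the block decides how this plane lies with respect to \<open>h\<close>.

  If the block has more than two rows, the plane is totally isotropic. After complexification,
  \<open>y = a + ib\<close> is a null eigenvector with eigenvalue \<open>c \<noteq> 0\<close>. Then \<open>h(y, S u) = c h(y, u)\<close>, and
  the derivation \<open>R(u, y)\<close> sends a bivector \<open>v \<and> y\<close> to
  \<open>(h(y, v) S u - c h(y, u) v) \<and> y\<close>, and the vector in brackets is orthogonal to \<open>y\<close>. Because of this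
  cancellation \<open>R\<^sup>k\<omega>(u\<^sub>1, y, \<dots>, u\<^sub>k, y, z, w)\<close> has a closed form when \<open>w\<close> is orthogonal to \<open>y\<close>. For \<open>z = y\<close> it
  is \<open>\<omega>(y, w)\<close> times \<open>c\<^sup>k\<close> and the product of the numbers \<open>h(y, u\<^sub>i)\<close>, hence \<open>\<omega>(y, \<cdot>) = d h(y, \<cdot>)\<close> with \<open>d \<noteq> 0\<close>. For general \<open>z\<close> it gives
  \<open>\<omega>(S\<^sup>p u, w) + c d h(S\<^sup>p\<^sup>-\<^sup>1 u, w) = 0\<close>. Putting \<open>w = S\<^sup>p u\<close> shows that the quadratic form
  \<open>h(S\<^sup>p\<^sup>-\<^sup>1 u, S\<^sup>p u)\<close> vanishes on the orthogonal complement of \<open>y\<close>, so that every eigenvector in it with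
  non-zero eigenvalue is a multiple of \<open>y\<close>. The conjugate eigenvector \<open>a - ib\<close> contradicts this
  (\<open>null_eigenvector_unique\<close>, \<open>no_complex_eigenplane\<close>).

  If the block is a \<open>2 \<times> 2\<close> matrix, the plane is hyperbolic. The operator \<open>R(a, b)\<close> kills its orthogonal complement and
  acts on the plane with the eigenvalues \<open>\<plusminus>\<mu>\<close>, \<open>\<mu>\<^sup>2 = \<alpha>\<^sup>2 + \<beta>\<^sup>2\<close>; being trace-free there, it does not
  change the bivector \<open>a \<and> b\<close>. Inserting the pair \<open>(a, b)\<close> repeatedly therefore multiplies \<open>\<omega>\<close> and \<open>R\<omega>\<close>
  by powers of the weights of their arguments, and all components of non-zero weight vanish. This
  makes the plane \<open>\<omega>\<close>-orthogonal to its complement, then forces \<open>S\<close>, and after that \<open>h\<close>, to vanish on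
  the complement, which is impossible in dimension at least three (\<open>no_complementary_vector\<close>).

  The Gauss equation is derived in one chart: with \<open>F\<close> the immersion in coordinates,
  the third derivative of \<open>F\<close> is symmetric, and its antisymmetric part computed from the formulas of
  Gauss and Weingarten is the equation (\<open>gauss_equation\<close>).
\<close>

section \<open>Powers of an algebraic curvature tensor\<close>

text \<open>
  The data which the hypersurface induces on a tangent space. The field is a parameter because the
  same algebra is used over the reals and over the complex numbers.
\<close>
locale curvature_algebra = vector_space scale
  for scale :: "'k::field_char_0 \<Rightarrow> 'v::ab_group_add \<Rightarrow> 'v" (infixr "\<star>" 75) +
  fixes h \<omega> :: "'v \<Rightarrow> 'v \<Rightarrow> 'k" and S :: "'v \<Rightarrow> 'v"
  assumes h_add: "h (u + v) w = h u w + h v w"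
    and h_scale: "h (c \<star> u) w = c * h u w"
    and h_sym: "h u v = h v u"
    and h_nondegenerate: "(\<And>v. h u v = 0) \<Longrightarrow> u = 0"
    and \<omega>_add: "\<omega> (u + v) w = \<omega> u w + \<omega> v w"
    and \<omega>_scale: "\<omega> (c \<star> u) w = c * \<omega> u w"
    and \<omega>_skew: "\<omega> u v = - \<omega> v u"
    and \<omega>_nondegenerate: "(\<And>v. \<omega> u v = 0) \<Longrightarrow> u = 0"
    and S_add: "S (u + v) = S u + S v"
    and S_scale: "S (c \<star> u) = c \<star> S u"
    and S_selfadjoint: "h (S u) v = h u (S v)"
begin

definition curv :: "'v \<Rightarrow> 'v \<Rightarrow> 'v \<Rightarrow> 'v" where
  "curv a b v = h b v \<star> S a - h a v \<star> S b"

text \<open>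
  The value of \<open>R\<^sup>k\<omega>\<close> on \<open>k\<close> pairs of vectors, followed by \<open>z\<close> and \<open>w\<close>. Grouping the arguments into
  pairs keeps visible that each pair is inserted into a curvature operator and enters only through its
  bivector.
\<close>
function Rpow :: "('v \<times> 'v) list \<Rightarrow> 'v \<Rightarrow> 'v \<Rightarrow> 'k" where
  "Rpow [] z w = \<omega> z w"
| "Rpow (p # ps) z w =
     - ((\<Sum>j<length ps.
           Rpow (ps[j := (curv (fst p) (snd p) (fst (ps ! j)), snd (ps ! j))]) z w
         + Rpow (ps[j := (fst (ps ! j), curv (fst p) (snd p) (snd (ps ! j)))]) z w)
       + Rpow ps (curv (fst p) (snd p) z) w + Rpow ps z (curv (fst p) (snd p) w))"
  by pat_completeness auto
termination by (relation "Wellfounded.measure (\<lambda>(ps, z, w). length ps)") auto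

definition linear_form :: "('v \<Rightarrow> 'k) \<Rightarrow> bool" where
  "linear_form f \<longleftrightarrow> (\<forall>u v c. f (u + c \<star> v) = f u + c * f v)"

definition linear_op :: "('v \<Rightarrow> 'v) \<Rightarrow> bool" where
  "linear_op g \<longleftrightarrow> (\<forall>u v c. g (u + c \<star> v) = g u + c \<star> g v)"

lemma linear_form_0: "linear_form f \<Longrightarrow> f 0 = 0"
  unfolding linear_form_def by (metis add_cancel_right_right mult_zero_left scale_zero_left mult_1 scale_one)

lemma linear_form_add: "linear_form f \<Longrightarrow> f (u + v) = f u + f v"
  unfolding linear_form_def by (metis mult_1 scale_one)

lemma linear_form_scale: "linear_form f \<Longrightarrow> f (c \<star> v) = c * f v"
  using linear_form_0[of f] unfolding linear_form_def by (metis add_0)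

lemma linear_form_minus: "linear_form f \<Longrightarrow> f (- v) = - f v"
  using linear_form_scale[of f "-1" v] by simp

lemma linear_form_diff: "linear_form f \<Longrightarrow> f (u - v) = f u - f v"
  using linear_form_add[of f u "- v"] linear_form_minus[of f v] by simp

lemmas linear_form_simps = linear_form_0 linear_form_add linear_form_scale linear_form_minus
  linear_form_diff

lemma linear_form_sum: "(\<And>i. i \<in> I \<Longrightarrow> linear_form (f i)) \<Longrightarrow> linear_form (\<lambda>v. \<Sum>i\<in>I. f i v)"
  unfolding linear_form_def by (simp add: sum.distrib sum_distrib_left)

lemma linear_form_plus:
  "linear_form f \<Longrightarrow> linear_form g \<Longrightarrow> linear_form (\<lambda>v. f v + g v)"
  unfolding linear_form_def by (simp add: algebra_simps)

lemma linear_form_uminus: "linear_form f \<Longrightarrow> linear_form (\<lambda>v. - f v)"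
  unfolding linear_form_def by (simp add: algebra_simps)

lemma linear_form_comp: "linear_form f \<Longrightarrow> linear_op g \<Longrightarrow> linear_form (\<lambda>v. f (g v))"
  unfolding linear_form_def linear_op_def by simp

lemma h_add_right: "h u (v + w) = h u v + h u w"
  by (metis h_add h_sym)

lemma h_scale_right: "h u (c \<star> v) = c * h u v"
  by (metis h_scale h_sym)

lemma linear_form_h: "linear_form (h u)"
  by (simp add: linear_form_def h_add_right h_scale_right)

lemma linear_form_h_left: "linear_form (\<lambda>v. h v u)"
  by (simp add: linear_form_def h_add h_scale)

lemma linear_form_\<omega>_left: "linear_form (\<lambda>v. \<omega> v u)"
  by (simp add: linear_form_def \<omega>_add \<omega>_scale)

lemma linear_form_\<omega>: "linear_form (\<omega> u)"
  unfolding linear_form_def by (subst (1 2 3) \<omega>_skew) (simp add: \<omega>_add \<omega>_scale)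

lemmas h_simps = linear_form_simps[OF linear_form_h] linear_form_simps[OF linear_form_h_left]
lemmas \<omega>_simps = linear_form_simps[OF linear_form_\<omega>] linear_form_simps[OF linear_form_\<omega>_left]

lemma \<omega>_same: "\<omega> u u = 0"
  using \<omega>_skew[of u u] by simp

lemma S_0: "S 0 = 0" using S_scale[of 0 0] by simp
lemma S_minus: "S (- u) = - S u" using S_scale[of "-1" u] by simp
lemma S_diff: "S (u - v) = S u - S v" using S_add[of u "- v"] S_minus[of v] by simp
lemmas S_simps = S_0 S_minus S_diff S_add S_scale

lemma curv_swap: "curv b a v = - curv a b v"
  by (simp add: curv_def)

lemma linear_op_curv: "linear_op (curv a b)"
  by (simp add: linear_op_def curv_def h_simps algebra_simps scale_left_distrib scale_right_distrib
      scale_left_diff_distrib scale_right_diff_distrib)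

lemma linear_op_curv_1: "linear_op (\<lambda>a. curv a b v)"
  by (simp add: linear_op_def curv_def h_simps S_simps algebra_simps scale_left_distrib
      scale_right_distrib scale_left_diff_distrib scale_right_diff_distrib)

lemma linear_form_Rpow_aux:
  "linear_form (\<lambda>z. Rpow ps z w) \<and> linear_form (Rpow ps w)"
proof (induction ps arbitrary: w rule: measure_induct_rule[of length])
  case (less ps)
  show ?case
  proof (cases ps)
    case Nil then show ?thesis by (simp add: linear_form_\<omega>_left linear_form_\<omega>)
  next
    case (Cons p qs)
    have IH: "linear_form (\<lambda>z. Rpow rs z v)" "linear_form (Rpow rs v)"
      if "length rs = length qs" for rs v
      using less[of rs v] that Cons by auto
    have "linear_form (\<lambda>z. Rpow (p # qs) z w)" "linear_form (\<lambda>z. Rpow (p # qs) w z)"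
      unfolding Rpow.simps
      by (intro linear_form_uminus linear_form_plus linear_form_sum IH length_list_update refl
          linear_form_comp[OF IH(1) linear_op_curv] linear_form_comp[OF IH(2) linear_op_curv])+
    then show ?thesis using Cons by simp
  qed
qed

lemmas linear_form_Rpow = linear_form_Rpow_aux[THEN conjunct1] linear_form_Rpow_aux[THEN conjunct2]

lemma Rpow_skew: "Rpow ps z w = - Rpow ps w z"
proof (induction ps arbitrary: z w rule: measure_induct_rule[of length])
  case (less ps)
  show ?case
  proof (cases ps)
    case Nil then show ?thesis using \<omega>_skew[of z w] by simp
  next
    case (Cons p qs)
    have *: "Rpow rs z w = - Rpow rs w z" if "length rs = length qs" for rs z w
      using less[of rs z w] that Cons by simp
    have "(\<Sum>j<length qs. Rpow (qs[j := f j]) z w + Rpow (qs[j := g j]) z w)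
        = - (\<Sum>j<length qs. Rpow (qs[j := f j]) w z + Rpow (qs[j := g j]) w z)" for f g
      unfolding sum_negf[symmetric] by (intro sum.cong refl) (subst (1 2) *, auto)
    then show ?thesis unfolding Cons Rpow.simps
      using *[of qs "curv (fst p) (snd p) z" w] *[of qs z "curv (fst p) (snd p) w"]
      by (simp add: algebra_simps)
  qed
qed

text \<open>
  Linearity in the second entry of a pair follows from linearity in the first one and
  antisymmetry, but both are needed in the induction step: the curvature operator of an earlier pair
  acts on either entry.
\<close>
lemma Rpow_pair_aux:
  "j < length ps \<Longrightarrow> linear_form (\<lambda>a. Rpow (ps[j := (a, b)]) z w)
     \<and> Rpow (ps[j := (a, b)]) z w = - Rpow (ps[j := (b, a)]) z w"
proof (induction ps arbitrary: j a b z w rule: measure_induct_rule[of length])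
  case (less ps)
  from \<open>j < length ps\<close> obtain p qs where ps: "ps = p # qs" by (cases ps) auto
  have IH1: "linear_form (\<lambda>a. Rpow (rs[i := (a, b)]) z w)"
    and IH2: "Rpow (rs[i := (a, b)]) z w = - Rpow (rs[i := (b, a)]) z w"
    if "length rs = length qs" "i < length qs" for rs i a b z w
    using less.IH[of rs i b z w a] that ps by simp_all
  have IH3: "linear_form (\<lambda>b. Rpow (rs[i := (a, b)]) z w)"
    if "length rs = length qs" "i < length qs" for rs i a z w
    using linear_form_uminus[OF IH1[OF that, of a z w]] IH2[OF that, of a _ z w] by simp
  show ?case
  proof
    show "linear_form (\<lambda>a. Rpow (ps[j := (a, b)]) z w)"
    proof (cases j)
      case 0
      show ?thesis unfolding ps 0 list_update_code Rpow.simps fst_conv snd_conv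
        by (intro linear_form_uminus linear_form_plus linear_form_sum
            linear_form_comp[OF IH1 linear_op_curv_1] linear_form_comp[OF IH3 linear_op_curv_1]
            linear_form_comp[OF linear_form_Rpow(1) linear_op_curv_1]
            linear_form_comp[OF linear_form_Rpow(2) linear_op_curv_1]) auto
    next
      case (Suc j')
      then have j': "j' < length qs" using less.prems ps by simp
      let ?A = "curv (fst p) (snd p)"
      have slots: "linear_form (\<lambda>a. Rpow (qs[j' := (a, b), i := (?A (fst (qs[j' := (a, b)] ! i)), snd (qs[j' := (a, b)] ! i))]) z w
          + Rpow (qs[j' := (a, b), i := (fst (qs[j' := (a, b)] ! i), ?A (snd (qs[j' := (a, b)] ! i)))]) z w)"
        if "i < length qs" for i
      proof (cases "i = j'")
        case True
        then show ?thesis using j'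
          by (simp add: linear_form_plus linear_form_comp[OF IH1 linear_op_curv] IH1)
      next
        case False
        then show ?thesis using j' that
          by (simp add: list_update_swap[of j' i] linear_form_plus IH1)
      qed
      then show ?thesis unfolding ps Suc list_update_code Rpow.simps length_list_update
        by (intro linear_form_uminus linear_form_plus[OF linear_form_plus[OF linear_form_sum[OF slots]]] IH1[OF refl j'])
          simp
    qed
  next
    show "Rpow (ps[j := (a, b)]) z w = - Rpow (ps[j := (b, a)]) z w"
    proof (cases j)
      case 0
      show ?thesis unfolding ps 0 list_update_code Rpow.simps fst_conv snd_conv curv_swap[of b a]
        by (simp add: linear_form_minus[OF IH1] linear_form_minus[OF IH3]
            linear_form_minus[OF linear_form_Rpow(1)] linear_form_minus[OF linear_form_Rpow(2)]
            sum_negf[symmetric] algebra_simps sum_subtractf cong: sum.cong_simp)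
    next
      case (Suc j')
      then have j': "j' < length qs" using less.prems ps by simp
      let ?A = "curv (fst p) (snd p)"
      let ?s = "\<lambda>a b i. Rpow (qs[j' := (a, b), i := (?A (fst (qs[j' := (a, b)] ! i)), snd (qs[j' := (a, b)] ! i))]) z w
          + Rpow (qs[j' := (a, b), i := (fst (qs[j' := (a, b)] ! i), ?A (snd (qs[j' := (a, b)] ! i)))]) z w"
      have "?s a b i = - ?s b a i" if "i < length qs" for i
      proof (cases "i = j'")
        case True
        then show ?thesis using j' IH2[of qs j' "?A a" b z w] IH2[of qs j' a "?A b" z w]
          by simp
      next
        case False
        have "Rpow (qs[j' := (a, b), i := q]) z w = - Rpow (qs[j' := (b, a), i := q]) z w" for q
          using IH2[of "qs[i := q]" j' a b z w] j' False by (simp add: list_update_swap[of j' i])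
        then show ?thesis using False by simp
      qed
      then have "(\<Sum>i<length qs. ?s a b i) = - (\<Sum>i<length qs. ?s b a i)"
        by (simp add: sum_negf[symmetric])
      then show ?thesis unfolding ps Suc list_update_code Rpow.simps length_list_update
        using IH2[OF refl j', of a b "?A z" w] IH2[OF refl j', of a b z "?A w"]
        by (simp add: algebra_simps)
    qed
  qed
qed

lemmas Rpow_pair = Rpow_pair_aux[THEN conjunct1] Rpow_pair_aux[THEN conjunct2]

lemma linear_form_Rpow_snd: "j < length ps \<Longrightarrow> linear_form (\<lambda>b. Rpow (ps[j := (a, b)]) z w)"
  using linear_form_uminus[OF Rpow_pair(1)[of j ps a z w]] Rpow_pair(2)[of j ps a _ z w] by simp

lemma Rpow_pair_same: "j < length ps \<Longrightarrow> Rpow (ps[j := (a, a)]) z w = 0"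
  using Rpow_pair(2)[of j ps a a z w] by simp

lemma Rpow_same: "Rpow ps z z = 0"
  using Rpow_skew[of ps z z] by simp

subsection \<open>Functionals and powers of the shape operator\<close>

text \<open>
  A functional that vanishes on the hyperplane orthogonal to \<open>y\<close> is a multiple of \<open>h(y, \<cdot>)\<close>, since any
  vector is, up to the hyperplane, a multiple of \<open>x\<close>.
\<close>
lemma functional_eq_multiple:
  assumes f: "linear_form f" and van: "\<And>v. h y v = 0 \<Longrightarrow> f v = 0" and x: "h y x = 1"
  shows "f v = f x * h y v"
proof -
  have "f (v - h y v \<star> x) = 0" by (intro van) (simp add: h_simps x)
  then show ?thesis by (simp add: linear_form_simps[OF f])
qed

lemma ex_dual_vector:
  assumes "y \<noteq> 0" obtains x where "h y x = 1"
proof -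
  obtain v where "h y v \<noteq> 0" using h_nondegenerate assms by blast
  then have "h y ((1 / h y v) \<star> v) = 1" by (simp add: h_simps)
  then show ?thesis by (rule that)
qed

lemma S_power_selfadjoint: "h ((S ^^ k) u) v = h u ((S ^^ k) v)"
proof (induction k arbitrary: u v)
  case (Suc k)
  then show ?case by (simp add: S_selfadjoint funpow_swap1[of S k v])
qed simp

lemma S_power_eigenvector: "S u = c \<star> u \<Longrightarrow> (S ^^ k) u = c ^ k \<star> u"
  by (induction k) (simp_all add: S_scale mult.commute)

lemma S_power_add: "(S ^^ k) (u + v) = (S ^^ k) u + (S ^^ k) v"
  by (induction k) (simp_all add: S_add)

subsection \<open>Null eigenvectors of the shape operator\<close>

text \<open>
  The components of \<open>R\<^sup>k\<omega>\<close> in which every pair is of the form \<open>(u, y)\<close>. For a null eigenvector \<open>y\<close> these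
  components are closed under the recursion.
\<close>
definition Qpow :: "'v \<Rightarrow> 'v list \<Rightarrow> 'v \<Rightarrow> 'v \<Rightarrow> 'k" where
  "Qpow y us z w = Rpow (map (\<lambda>u. (u, y)) us) z w"

lemma linear_form_Qpow_slot:
  assumes "j < length us" shows "linear_form (\<lambda>u. Qpow y (us[j := u]) z w)"
  unfolding Qpow_def using Rpow_pair(1)[of j "map (\<lambda>u. (u, y)) us" y z w] assms
  by (simp add: map_update)

lemma linear_form_Qpow: "linear_form (\<lambda>z. Qpow y us z w)" "linear_form (Qpow y us z)"
  unfolding Qpow_def by (rule linear_form_Rpow)+

lemma Qpow_same: "Qpow y us z z = 0"
  unfolding Qpow_def by (rule Rpow_same)

lemma Qpow_Nil: "Qpow y [] z w = \<omega> z w"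
  by (simp add: Qpow_def)

lemma curv_null_eigenvector:
  assumes "S y = c \<star> y"
  shows "curv u y v = h y v \<star> S u - (c * h u v) \<star> y"
  by (simp add: curv_def assms mult.commute)

text \<open>
  The operator \<open>R(u, y)\<close> multiplies the null eigenvector \<open>y\<close> by \<open>- c h(y, u)\<close>, so its action on the second entry of a
  pair can be moved to the first one; the multiple of \<open>y\<close> that it produces in the first entry is
  lost, because the pair \<open>(y, y)\<close> contributes nothing.
\<close>
lemma Qpow_Cons:
  assumes Sy: "S y = c \<star> y" and null: "h y y = 0"
  shows "Qpow y (u # us) z w =
     - ((\<Sum>j<length us. Qpow y (us[j := h y (us ! j) \<star> S u - (c * h y u) \<star> us ! j]) z w)
       + Qpow y us (h y z \<star> S u - (c * h u z) \<star> y) w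
       + Qpow y us z (h y w \<star> S u - (c * h u w) \<star> y))"
proof -
  let ?ps = "map (\<lambda>u. (u, y)) us"
  have "Rpow (?ps[j := (curv u y (fst (?ps ! j)), snd (?ps ! j))]) z w
      + Rpow (?ps[j := (fst (?ps ! j), curv u y (snd (?ps ! j)))]) z w
      = Qpow y (us[j := h y (us ! j) \<star> S u - (c * h y u) \<star> us ! j]) z w" if j: "j < length us" for j
  proof -
    have j': "j < length ?ps" using j by simp
    note lin = linear_form_simps[OF Rpow_pair(1)[OF j', of _ z w]]
      linear_form_simps[OF linear_form_Rpow_snd[OF j', of _ z w]]
    show ?thesis
      by (simp add: j Qpow_def map_update curv_null_eigenvector[OF Sy] null h_sym[of u y] lin Rpow_pair_same[OF j'])
  qed
  then show ?thesis
    by (simp add: Qpow_def curv_null_eigenvector[OF Sy])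
qed

text \<open>
  The cancellation behind all closed forms below: the recursion replaces a slot by a vector
  orthogonal to \<open>y\<close>.
\<close>
lemma h_slot_zero:
  assumes "S y = c \<star> y"
  shows "h y (h y v \<star> S u - (c * h y u) \<star> v) = 0"
  using S_selfadjoint[of y u] by (simp add: h_simps assms)

lemma prod_list_update_0:
  fixes f :: "'v \<Rightarrow> 'k"
  assumes "j < length us" "f v = 0" shows "prod_list (map f (us[j := v])) = 0"
  using assms by (metis length_map list_update_same_conv map_update nth_list_update_eq
      nth_mem prod_list_zero_iff length_list_update)

context
  fixes y :: 'v and c :: 'k
  assumes Sy: "S y = c \<star> y" and null: "h y y = 0" and y0: "y \<noteq> 0" and c0: "c \<noteq> 0"
begin

text \<open>
  The terms in which a slot is replaced contain a factor \<open>h(y, \<cdot>) = 0\<close>, so only the action on the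
  argument \<open>y\<close>, multiplication by \<open>- c h(y, u)\<close>, survives.
\<close>
lemma Qpow_eigenvector_perp:
  assumes w: "h y w = 0"
  shows "Qpow y us y w = c ^ length us * prod_list (map (h y) us) * \<omega> y w"
proof (induction us rule: measure_induct_rule[of length])
  case (less us)
  show ?case
  proof (cases us)
    case Nil then show ?thesis by (simp add: Qpow_Nil)
  next
    case (Cons u vs)
    have IH: "Qpow y rs y w = c ^ length rs * prod_list (map (h y) rs) * \<omega> y w"
      if "length rs = length vs" for rs using less[of rs] that Cons by simp
    have "(\<Sum>j<length vs. Qpow y (vs[j := h y (vs ! j) \<star> S u - (c * h y u) \<star> vs ! j]) y w) = 0"
      by (intro sum.neutral)
        (simp add: IH prod_list_update_0[where f = "h y", OF _ h_slot_zero[OF Sy]])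
    then have "Qpow y (u # vs) y w = c * h y u * Qpow y vs y w"
      unfolding Qpow_Cons[OF Sy null] by (simp add: null w linear_form_simps[OF linear_form_Qpow(1)]
         linear_form_simps[OF linear_form_Qpow(2)] Qpow_same h_sym[of u y])
    then show ?thesis by (simp add: Cons IH)
  qed
qed

lemma \<omega>_proportional:
  assumes "\<And>us z w. length us = p \<Longrightarrow> Qpow y us z w = 0"
  obtains d where "d \<noteq> 0" "\<And>v. \<omega> y v = d * h y v"
proof -
  obtain x where x: "h y x = 1" using ex_dual_vector[OF y0] .
  have "\<omega> y w = 0" if "h y w = 0" for w
    using Qpow_eigenvector_perp[OF that, of "replicate p x"] assms[of "replicate p x" y w] c0
    by (simp add: x)
  from functional_eq_multiple[OF linear_form_\<omega> this x] have *: "\<omega> y v = \<omega> y x * h y v" for v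
    by blast
  have "\<omega> y x \<noteq> 0"
  proof
    assume 0: "\<omega> y x = 0"
    have "\<omega> y v = 0" for v using *[of v] unfolding 0 by simp
    then show False using \<omega>_nondegenerate y0 by blast
  qed
  then show ?thesis using * that by blast
qed

context
  fixes d :: 'k
  assumes \<omega>y: "\<And>v. \<omega> y v = d * h y v"
begin

text \<open>
  For a single pair, the actions on \<open>z\<close> and on \<open>y\<close> cancel because \<open>\<omega>(y, \<cdot>)\<close> is a multiple of \<open>h(y, \<cdot>)\<close>; longer lists
  reduce to shorter non-empty ones.
\<close>
lemma Qpow_eigenvector: "Qpow y (u # us) z y = 0"
proof (induction us arbitrary: u z rule: measure_induct_rule[of length])
  case (less us)
  show ?case
  proof (cases us)
    case Nil
    have "\<omega> (S u) y = - (d * (c * h y u))"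
      using \<omega>_skew[of "S u" y] \<omega>y[of "S u"] S_selfadjoint[of y u] by (simp add: Sy h_simps)
    moreover have "\<omega> z y = - (d * h y z)" using \<omega>_skew[of z y] \<omega>y by simp
    ultimately show ?thesis
      by (simp add: Nil Qpow_Cons[OF Sy null] Qpow_Nil null \<omega>_simps \<omega>_same h_sym[of u y])
  next
    case (Cons v vs)
    have "Qpow y (us[j := a]) z y = 0" if "j < length us" for j a z
      using Cons less[of "tl (us[j := a])" "hd (us[j := a])" z] that
      by (cases j) (auto)
    moreover have "Qpow y us z y = 0" for z using Cons less[of vs v z] by simp
    ultimately show ?thesis
      by (simp add: Qpow_Cons[OF Sy null] null linear_form_simps[OF linear_form_Qpow(1)]
         linear_form_simps[OF linear_form_Qpow(2)])
  qed
qed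

text \<open>
  In the recursion, replacing a slot other than the first one of the tail gives zero by
  orthogonality. Replacing that first slot \<open>v\<close> gives a term in \<open>S u\<close> and a term in \<open>v\<close>, and the latter cancels
  against the action on \<open>z\<close>. What is left is the same expression with \<open>S u\<close> as its first slot, one
  pair shorter, with the opposite sign.
\<close>
lemma Qpow_perp:
  assumes w: "h y w = 0"
  shows "Qpow y (u # us) z w = h y z * prod_list (map (h y) us) * (-1) ^ Suc (length us)
     * (\<omega> ((S ^^ Suc (length us)) u) w + c * d * h ((S ^^ length us) u) w)"
proof -
  have main: "\<forall>us u z. length us = k \<longrightarrow> Qpow y (u # us) z w = h y z * prod_list (map (h y) us) * (-1) ^ Suc k
     * (\<omega> ((S ^^ Suc k) u) w + c * d * h ((S ^^ k) u) w)" for k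
  proof (induction k)
    case 0
    have "\<omega> z y = - (d * h y z)" for z using \<omega>_skew[of z y] \<omega>y by simp
    then show ?case
      by (simp add: Qpow_Cons[OF Sy null] Qpow_Nil w \<omega>_simps \<omega>y algebra_simps)
  next
    case (Suc k)
    let ?g = "\<lambda>u. (-1) ^ Suc k * (\<omega> ((S ^^ Suc k) u) w + c * d * h ((S ^^ k) u) w)"
    show ?case
    proof (intro allI impI)
      fix us u z assume "length (us :: 'v list) = Suc k"
      then obtain v vs where us: "us = v # vs" and k: "length vs = k" by (cases us) auto
      let ?v = "\<lambda>v. h y v \<star> S u - (c * h y u) \<star> v"
      have IH: "Qpow y (a # rs) b w = h y b * prod_list (map (h y) rs) * ?g a"
        if "length rs = k" for a rs b using Suc that by (simp add: mult.assoc)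
      have "(\<Sum>j<length us. Qpow y (us[j := ?v (us ! j)]) z w) = Qpow y (?v v # vs) z w
          + (\<Sum>j<k. Qpow y (v # vs[j := ?v (vs ! j)]) z w)"
        unfolding us by (simp add: k sum.lessThan_Suc_shift del: sum.lessThan_Suc)
      also have "(\<Sum>j<k. Qpow y (v # vs[j := ?v (vs ! j)]) z w) = 0"
        by (intro sum.neutral)
          (simp add: IH k prod_list_update_0[where f = "h y", OF _ h_slot_zero[OF Sy]])
      also have "Qpow y (?v v # vs) z w
          = h y v * Qpow y (S u # vs) z w - c * h y u * Qpow y (v # vs) z w"
      proof -
        have "linear_form (\<lambda>a. Qpow y (a # vs) z w)"
          using linear_form_Qpow_slot[of 0 "v # vs" y z w] by simp
        from linear_form_simps[OF this] show ?thesis by simp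
      qed
      finally have slots: "(\<Sum>j<length us. Qpow y (us[j := ?v (us ! j)]) z w)
          = h y v * Qpow y (S u # vs) z w - c * h y u * Qpow y (v # vs) z w" by simp
      have "Qpow y us y w = 0"
        unfolding us using IH[OF k, of v y] by (simp add: null)
      moreover have "h y (S u) = c * h y u" using S_selfadjoint[of y u] by (simp add: Sy h_simps)
      then have "h y z * Qpow y us (S u) w = c * h y u * Qpow y us z w"
        unfolding us IH[OF k] by simp
      moreover have "Qpow y us z y = 0" unfolding us by (rule Qpow_eigenvector)
      ultimately have "Qpow y (u # us) z w = - (h y v * Qpow y (S u # vs) z w)"
        by (subst Qpow_Cons[OF Sy null], subst slots)
          (simp add: us w linear_form_simps[OF linear_form_Qpow(1)]
            linear_form_simps[OF linear_form_Qpow(2)])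
      then show "Qpow y (u # us) z w = h y z * prod_list (map (h y) us) * (-1) ^ Suc (Suc k)
         * (\<omega> ((S ^^ Suc (Suc k)) u) w + c * d * h ((S ^^ Suc k) u) w)"
        by (simp add: IH[OF k] us funpow_swap1 mult_ac)
    qed
  qed
  show ?thesis using main[of "length us"] by simp
qed

end

text \<open>
  The closed form gives \<open>\<omega>(S\<^sup>p v, w) = - c d h(S\<^sup>p\<^sup>-\<^sup>1 v, w)\<close> for \<open>w\<close> orthogonal to \<open>y\<close>. With \<open>w = S\<^sup>p v\<close>
  the left-hand side vanishes; polarizing the resulting quadratic identity at the eigenvector \<open>u\<close>
  shows that \<open>u\<close> is orthogonal to the whole complement of \<open>y\<close>.
\<close>
theorem null_eigenvector_unique:
  assumes van: "\<And>ps z w. length ps = p \<Longrightarrow> Rpow ps z w = 0" and p: "p \<ge> 1"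
    and Su: "S u = e \<star> u" and e0: "e \<noteq> 0" and perp: "h y u = 0"
  obtains b where "u = b \<star> y"
proof -
  have Q0: "Qpow y us z w = 0" if "length us = p" for us z w
    using that by (simp add: Qpow_def van)
  obtain d where d0: "d \<noteq> 0" and \<omega>y: "\<And>v. \<omega> y v = d * h y v" using \<omega>_proportional[OF Q0] by blast
  obtain x where x: "h y x = 1" using ex_dual_vector[OF y0] .
  obtain k where k: "p = Suc k" using p by (cases p) auto
  have rel: "\<omega> ((S ^^ Suc k) v) w = - (c * d * h ((S ^^ k) v) w)" if "h y w = 0" for v w
    using Qpow_perp[OF \<omega>y that, of v "replicate k x" x] Q0[of "v # replicate k x" x w]
    by (simp add: k x eq_neg_iff_add_eq_0)
  have perp_S: "h y ((S ^^ j) v) = 0" if "h y v = 0" for v j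
    using S_power_selfadjoint[of j y v] S_power_eigenvector[OF Sy, of j] that by (simp add: h_simps)
  \<comment> \<open>The relation with \<open>w = S\<^sup>p v\<close>, where \<open>\<omega>\<close> vanishes because it is alternating.\<close>
  have quad: "h ((S ^^ k) v) ((S ^^ Suc k) v) = 0" if "h y v = 0" for v
    using rel[OF perp_S[OF that], of v "Suc k"] c0 d0 by (simp add: \<omega>_same)
  have "h u v = 0" if v: "h y v = 0" for v
  proof -
    have "h y (u + v) = 0" by (simp add: h_simps perp v)
    from quad[OF this] quad[OF v] quad[OF perp]
    have "h ((S ^^ k) u) ((S ^^ Suc k) v) + h ((S ^^ k) v) ((S ^^ Suc k) u) = 0"
      by (simp add: S_power_add h_simps S_add add.commute)
    moreover have "h ((S ^^ k) u) ((S ^^ Suc k) v) = e ^ k * e ^ Suc k * h u v"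
      using S_power_selfadjoint[of "Suc k" u v]
      by (simp add: S_power_eigenvector[OF Su] h_simps Su S_scale mult_ac)
    moreover have "h ((S ^^ k) v) ((S ^^ Suc k) u) = e ^ k * e ^ Suc k * h u v"
      using S_power_selfadjoint[of k v u]
      by (simp add: S_power_eigenvector[OF Su] h_simps Su S_scale mult_ac h_sym[of v u])
    ultimately have "e ^ k * e ^ Suc k * h u v + e ^ k * e ^ Suc k * h u v = 0" by metis
    then have "2 * (e ^ k * e ^ Suc k * h u v) = 0" unfolding mult_2 .
    then show ?thesis using e0 by simp
  qed
  then have "h u v = h u x * h y v" for v
    using functional_eq_multiple[OF linear_form_h _ x] by blast
  then have "h u v - h u x * h y v = 0" for v by (metis diff_self)
  then have "h (u - h u x \<star> y) v = 0" for v by (simp only: h_simps)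
  then have "u - h u x \<star> y = 0" using h_nondegenerate by blast
  then show ?thesis using that[of "h u x"] by simp
qed

end

subsection \<open>Hyperbolic planes with a complex eigenvalue\<close>

text \<open>
  The derivation \<open>R(a, b)\<close> multiplies the bivector of the pair \<open>q\<close> by \<open>m\<close>, tested inside every component
  of every power of \<open>R\<close>.
\<close>
definition pair_weight :: "'v \<Rightarrow> 'v \<Rightarrow> 'v \<times> 'v \<Rightarrow> 'k \<Rightarrow> bool" where
  "pair_weight a b q m \<longleftrightarrow> (\<forall>ps j z w. j < length ps \<longrightarrow>
      Rpow (ps[j := (curv a b (fst q), snd q)]) z w + Rpow (ps[j := (fst q, curv a b (snd q))]) z w
    = m * Rpow (ps[j := q]) z w)"

text \<open>
  If all arguments are weight vectors, inserting the pair \<open>(a, b)\<close> in front only multiplies by the total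
  weight.
\<close>
lemma Rpow_Cons_weight:
  assumes "\<And>q. q \<in> set ps \<Longrightarrow> pair_weight a b q (m q)"
    and "curv a b z = s \<star> z" "curv a b w = t \<star> w"
  shows "Rpow ((a, b) # ps) z w = - (sum_list (map m ps) + s + t) * Rpow ps z w"
proof -
  have "(\<Sum>j<length ps. Rpow (ps[j := (curv a b (fst (ps ! j)), snd (ps ! j))]) z w
      + Rpow (ps[j := (fst (ps ! j), curv a b (snd (ps ! j)))]) z w)
    = (\<Sum>j<length ps. m (ps ! j) * Rpow ps z w)"
    using assms(1) unfolding pair_weight_def by (intro sum.cong) auto
  also have "\<dots> = sum_list (map m ps) * Rpow ps z w"
    by (simp add: sum_list_sum_nth atLeast0LessThan sum_distrib_right)
  finally show ?thesis
    by (simp add: assms(2,3) linear_form_simps[OF linear_form_Rpow(1)]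
        linear_form_simps[OF linear_form_Rpow(2)] algebra_simps)
qed

lemma Rpow_replicate_weight:
  assumes "pair_weight a b (a, b) 0" "\<And>q. q \<in> set qs \<Longrightarrow> pair_weight a b q (m q)"
    and "curv a b z = s \<star> z" "curv a b w = t \<star> w" "m (a, b) = 0"
  shows "Rpow (replicate k (a, b) @ qs) z w = (- (sum_list (map m qs) + s + t)) ^ k * Rpow qs z w"
proof (induction k)
  case (Suc k)
  have "Rpow ((a, b) # replicate k (a, b) @ qs) z w
      = - (sum_list (map m (replicate k (a, b) @ qs)) + s + t) * Rpow (replicate k (a, b) @ qs) z w"
    by (intro Rpow_Cons_weight assms(3,4)) (use assms in \<open>auto split: if_splits\<close>)
  moreover have "sum_list (map m (replicate k (a, b))) = 0"
    using assms(5) by (induction k) auto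
  ultimately show ?case using Suc by simp
qed simp

lemma pair_weight_eigenvectors:
  assumes "curv a b u = s \<star> u" "curv a b v = t \<star> v"
  shows "pair_weight a b (u, v) (s + t)"
  unfolding pair_weight_def
  by (auto simp: assms linear_form_simps[OF Rpow_pair(1)] linear_form_simps[OF linear_form_Rpow_snd]
      algebra_simps)

text \<open>
  Let \<open>A = R(a, b)\<close>. It vanishes on the orthogonal complement of the plane and satisfies \<open>A\<^sup>2 = \<mu>\<^sup>2\<close> on the plane.
  Components of \<open>R\<^sup>p\<omega>\<close> with \<open>(a, b)\<close> in all or in all but the last pair determine those components of \<open>\<omega>\<close>
  and of \<open>R\<omega>\<close> whose weight under \<open>A\<close> is non-zero. The former separate the plane from its complement
  with respect to \<open>\<omega>\<close>; the latter then show that \<open>h\<close> vanishes on the complement, which is therefore zero.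
\<close>
theorem no_complementary_vector:
  assumes van: "\<And>ps z w. length ps = p \<Longrightarrow> Rpow ps z w = 0" and p: "p \<ge> 1"
    and Sa: "S a = \<alpha> \<star> a - \<beta> \<star> b" and Sb: "S b = \<beta> \<star> a + \<alpha> \<star> b"
    and h: "h a a = 0" "h b b = 0" "h a b = 1"
    and \<mu>: "\<mu>\<^sup>2 = \<alpha>\<^sup>2 + \<beta>\<^sup>2" "\<mu> \<noteq> 0" and \<beta>: "\<beta> \<noteq> 0"
  obtains s t where "v = s \<star> a + t \<star> b"
proof -
  have hba: "h b a = 1" using h(3) h_sym by metis
  have Aa: "curv a b a = \<alpha> \<star> a - \<beta> \<star> b" and Ab: "curv a b b = - (\<beta> \<star> a + \<alpha> \<star> b)"
    by (simp_all add: curv_def h hba Sa Sb)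
  define perp where "perp v \<longleftrightarrow> h a v = 0 \<and> h b v = 0" for v
  have Aw: "curv a b w = 0 \<star> w" if "perp w" for w using that by (simp add: curv_def perp_def)
  have perp_S: "perp (S w)" if "perp w" for w
    using that S_selfadjoint[of a w] S_selfadjoint[of b w]
    by (simp add: perp_def Sa Sb h_simps)
  have ab: "pair_weight a b (a, b) 0"
    unfolding pair_weight_def
    by (auto simp: Aa Ab linear_form_simps[OF Rpow_pair(1)] linear_form_simps[OF linear_form_Rpow_snd]
      Rpow_pair_same)
  have eig: "curv a b ((\<alpha> + m) \<star> a - \<beta> \<star> b) = m \<star> ((\<alpha> + m) \<star> a - \<beta> \<star> b)" 
    if "m\<^sup>2 = \<alpha>\<^sup>2 + \<beta>\<^sup>2" for m
  proof -
    have "curv a b ((\<alpha> + m) \<star> a - \<beta> \<star> b) = (\<alpha> + m) \<star> curv a b a - \<beta> \<star> curv a b b"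
      using linear_op_curv[of a b] by (simp add: curv_def h_simps algebra_simps scale_right_diff_distrib)
    also have "\<dots> = ((\<alpha> + m) * \<alpha> + \<beta> * \<beta>) \<star> a - (m * \<beta>) \<star> b"
      by (simp add: Aa Ab algebra_simps scale_left_distrib scale_right_distrib
      scale_left_diff_distrib scale_right_diff_distrib)
    also have "(\<alpha> + m) * \<alpha> + \<beta> * \<beta> = m * (\<alpha> + m)" using that by (simp add: algebra_simps power2_eq_square)
    finally show ?thesis by (simp add: scale_right_diff_distrib)
  qed
  have \<omega>_eig: "\<omega> ((\<alpha> + m) \<star> a - \<beta> \<star> b) w = 0" if "m\<^sup>2 = \<alpha>\<^sup>2 + \<beta>\<^sup>2" "m \<noteq> 0" "perp w" for m w
    using Rpow_replicate_weight[of a b "[]" "\<lambda>_. 0", OF ab _ eig[OF that(1)] Aw[OF that(3)], of p]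
      van[of "replicate p (a, b)"] that(2) by simp
  \<comment> \<open>The eigenvectors for \<open>\<mu>\<close> and \<open>- \<mu>\<close> span the plane.\<close>
  have \<omega>_plane: "\<omega> a w = 0" "\<omega> b w = 0" if "perp w" for w
  proof -
    have "(\<alpha> + \<mu>) * \<omega> a w - \<beta> * \<omega> b w = 0" "(\<alpha> - \<mu>) * \<omega> a w - \<beta> * \<omega> b w = 0"
      using \<omega>_eig[of \<mu> w] \<omega>_eig[of "- \<mu>" w] \<mu> that by (simp_all add: \<omega>_simps)
    moreover from this have "2 * \<mu> * \<omega> a w = 0" by (simp add: algebra_simps)
    ultimately show "\<omega> a w = 0" "\<omega> b w = 0" using \<mu> \<beta> by simp_all
  qed
  have decomp: "perp (w - h b w \<star> a - h a w \<star> b)" for w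
    by (simp add: perp_def h_simps h hba)
  have "a \<noteq> 0" using h(3) h_simps by auto
  have ab0: "\<omega> a b \<noteq> 0"
  proof
    assume 0: "\<omega> a b = 0"
    have "\<omega> a w = 0" for w
      using \<omega>_plane(1)[OF decomp[of w]] 0 by (simp add: \<omega>_simps \<omega>_same)
    then show False using \<omega>_nondegenerate \<open>a \<noteq> 0\<close> by blast
  qed
  \<comment> \<open>The eigenvector \<open>A a + \<mu> a\<close> of \<open>A\<close> with eigenvalue \<open>\<mu>\<close>.\<close>
  define u where "u = (\<alpha> + \<mu>) \<star> a - \<beta> \<star> b"
  have Au: "curv a b u = \<mu> \<star> u" unfolding u_def by (intro eig \<mu>)
  have u_perp: "h u w = 0" "\<omega> u w = 0" if "perp w" for w
    using that \<omega>_plane[OF that] by (simp_all add: u_def h_simps perp_def \<omega>_simps)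
  have \<omega>u: "\<omega> u (S u) \<noteq> 0"
  proof -
    have "\<omega> u (S u) = - \<beta> * ((\<alpha> + \<mu>)\<^sup>2 + \<beta>\<^sup>2) * \<omega> a b"
      by (simp add: u_def S_simps Sa Sb \<omega>_simps \<omega>_same \<omega>_skew[of b a] algebra_simps power2_eq_square)
    also have "(\<alpha> + \<mu>)\<^sup>2 + \<beta>\<^sup>2 = (\<alpha>\<^sup>2 + \<beta>\<^sup>2) + \<mu>\<^sup>2 + 2 * \<alpha> * \<mu>"
      by (simp add: power2_sum)
    also have "\<dots> = 2 * \<mu> * (\<mu> + \<alpha>)"
      unfolding \<mu>(1)[symmetric] by (simp add: algebra_simps power2_eq_square)
    finally show ?thesis using \<mu> \<beta> ab0 by (auto simp: add_eq_0_iff2)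
  qed
  \<comment> \<open>The component \<open>(u, z, u, w)\<close> of \<open>R\<omega>\<close> has weight \<open>2\<mu>\<close>, so it vanishes.\<close>
  have key: "h u u * \<omega> (S z) w = h z w * \<omega> u (S u)" if z: "perp z" and w: "perp w" for z w
  proof -
    obtain k where k: "p = Suc k" using p by (cases p) auto
    \<comment> \<open>The pair \<open>(a, b)\<close> has weight zero; for \<open>m\<close> to reflect this, \<open>(u, z)\<close> must differ from \<open>(a, b)\<close>.\<close>
    define m where "m q = (if q = (u, z) then \<mu> else 0)" for q
    have "h a u = - \<beta>" by (simp add: u_def h_simps h)
    then have "u \<noteq> a" using h(1) \<beta> by auto
    have "pair_weight a b (u, z) \<mu>" using pair_weight_eigenvectors[OF Au Aw[OF z]] by simp
    then have "Rpow (replicate k (a, b) @ [(u, z)]) u w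
        = (- (sum_list (map m [(u, z)]) + \<mu> + 0)) ^ k * Rpow [(u, z)] u w"
      by (intro Rpow_replicate_weight ab Au Aw w) (use \<open>u \<noteq> a\<close> in \<open>auto simp: m_def\<close>)
    then have "(- 2 * \<mu>) ^ k * Rpow [(u, z)] u w = 0"
      using van[of "replicate k (a, b) @ [(u, z)]"] k by (simp add: m_def)
    then have "Rpow [(u, z)] u w = 0" using \<mu> by simp
    then show ?thesis
      using u_perp[OF z] u_perp[OF w] u_perp[OF perp_S[OF z]] \<omega>_skew[of "S u" w]
      by (simp add: curv_def \<omega>_simps h_sym[of z u])
  qed
  \<comment> \<open>Taking \<open>w = S z\<close> removes the left-hand side of \<open>key\<close>.\<close>
  have zS: "h z (S z) = 0" if "perp z" for z
    using key[OF that perp_S[OF that]] \<omega>u by (simp add: \<omega>_same)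
  have zSw: "h z (S w) = 0" if z: "perp z" and w: "perp w" for z w
  proof -
    have "perp (z + w)" using z w by (simp add: perp_def h_simps)
    from zS[OF this] zS[OF z] zS[OF w] have "h z (S w) + h w (S z) = 0"
      by (simp add: S_add h_simps add.commute)
    moreover have "h w (S z) = h z (S w)" using S_selfadjoint[of z w] h_sym by metis
    ultimately have "2 * h z (S w) = 0" by simp
    then show ?thesis by simp
  qed
  have nondeg: "z = 0" if z: "perp z" and zw: "\<And>w. perp w \<Longrightarrow> h z w = 0" for z
  proof (rule h_nondegenerate)
    fix w
    show "h z w = 0"
      using zw[OF decomp[of w]] z h_sym[of z a] h_sym[of z b] by (simp add: h_simps perp_def)
  qed
  have Sz: "S z = 0" if z: "perp z" for z
    by (intro nondeg perp_S z) (metis zSw h_sym z)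
  have "z = 0" if z: "perp z" for z
    by (intro nondeg z) (use key[OF z] \<omega>u in \<open>auto simp: Sz[OF z] \<omega>_simps\<close>)
  then have "v - h b v \<star> a - h a v \<star> b = 0" using decomp by blast
  then show ?thesis using that[of "h b v" "h a v"] by (simp add: algebra_simps)
qed

end

section \<open>Complexification\<close>

text \<open>
  A pair \<open>(u, v)\<close> stands for \<open>u + iv\<close>.
\<close>
definition cscale :: "complex \<Rightarrow> 'v \<times> 'v \<Rightarrow> 'v::real_vector \<times> 'v" where
  "cscale z u = (Re z *\<^sub>R fst u - Im z *\<^sub>R snd u, Re z *\<^sub>R snd u + Im z *\<^sub>R fst u)"

definition complexified_form :: "('v \<Rightarrow> 'v \<Rightarrow> real) \<Rightarrow> 'v \<times> 'v \<Rightarrow> 'v \<times> 'v \<Rightarrow> complex" where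
  "complexified_form b u v = Complex (b (fst u) (fst v) - b (snd u) (snd v))
     (b (fst u) (snd v) + b (snd u) (fst v))"

lemma vector_space_cscale: "vector_space (cscale :: complex \<Rightarrow> 'v::real_vector \<times> 'v \<Rightarrow> 'v \<times> 'v)"
  by unfold_locales
    (auto simp: cscale_def algebra_simps)

locale real_curvature_algebra = curvature_algebra scaleR h \<omega> S
  for h \<omega> :: "'v::real_vector \<Rightarrow> 'v \<Rightarrow> real" and S :: "'v \<Rightarrow> 'v"
begin

sublocale complexified: curvature_algebra cscale "complexified_form h" "complexified_form \<omega>" "map_prod S S"
proof (intro curvature_algebra.intro vector_space_cscale curvature_algebra_axioms.intro)
  fix u v w :: "'v \<times> 'v" and c :: complex
  show "complexified_form h (u + v) w = complexified_form h u w + complexified_form h v w"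
    "complexified_form \<omega> (u + v) w = complexified_form \<omega> u w + complexified_form \<omega> v w"
    by (simp_all add: complexified_form_def complex_eq_iff h_simps \<omega>_simps)
  show "complexified_form h (cscale c u) w = c * complexified_form h u w"
    "complexified_form \<omega> (cscale c u) w = c * complexified_form \<omega> u w"
    by (simp_all add: complexified_form_def complex_eq_iff h_simps \<omega>_simps cscale_def algebra_simps)
  show "complexified_form h u v = complexified_form h v u"
    using h_sym[of "fst u"] h_sym[of "snd u"] by (simp add: complexified_form_def)
  show "complexified_form \<omega> u v = - complexified_form \<omega> v u"
    using \<omega>_skew[of "fst u" "fst v"] \<omega>_skew[of "fst u" "snd v"] \<omega>_skew[of "snd u" "fst v"]
      \<omega>_skew[of "snd u" "snd v"] by (simp add: complexified_form_def complex_eq_iff)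
  show "map_prod S S (u + v) = map_prod S S u + map_prod S S v"
    "map_prod S S (cscale c u) = cscale c (map_prod S S u)"
    by (cases u; cases v; simp add: S_simps cscale_def)+
  show "complexified_form h (map_prod S S u) v = complexified_form h u (map_prod S S v)"
    by (cases u; cases v; simp add: complexified_form_def S_selfadjoint)
next
  fix u :: "'v \<times> 'v"
  assume *: "\<And>v. complexified_form h u v = 0"
  have "h (fst u) a = 0" "h (snd u) a = 0" for a
    using *[of "(a, 0)"] by (simp_all add: complexified_form_def complex_eq_iff h_simps)
  then show "u = 0" using h_nondegenerate by (metis prod.collapse zero_prod_def)
next
  fix u :: "'v \<times> 'v"
  assume *: "\<And>v. complexified_form \<omega> u v = 0"
  have "\<omega> (fst u) a = 0" "\<omega> (snd u) a = 0" for a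
    using *[of "(a, 0)"] by (simp_all add: complexified_form_def complex_eq_iff \<omega>_simps)
  then show "u = 0" using \<omega>_nondegenerate by (metis prod.collapse zero_prod_def)
qed

definition \<iota> :: "'v \<Rightarrow> 'v \<times> 'v" where "\<iota> v = (v, 0)"

lemma complexified_curv: "complexified.curv (\<iota> a) (\<iota> b) (\<iota> v) = \<iota> (curv a b v)"
  by (simp add: complexified.curv_def curv_def \<iota>_def complexified_form_def cscale_def h_simps S_simps)

lemma complexified_Rpow:
  "complexified.Rpow (map (map_prod \<iota> \<iota>) ps) (\<iota> z) (\<iota> w) = of_real (Rpow ps z w)"
proof (induction ps arbitrary: z w rule: measure_induct_rule[of length])
  case (less ps)
  show ?case
  proof (cases ps)
    case Nil
    show ?thesis unfolding Nil list.map complexified.Rpow.simps Rpow.simps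
      by (simp add: \<iota>_def complexified_form_def complex_eq_iff \<omega>_simps)
  next
    case (Cons p qs)
    have IH: "complexified.Rpow ((map (map_prod \<iota> \<iota>) qs)[j := (\<iota> a, \<iota> b)]) (\<iota> z) (\<iota> w)
        = of_real (Rpow (qs[j := (a, b)]) z w)" for j a b
      using less[of "qs[j := (a, b)]" z w] Cons by (simp add: map_update)
    have IH': "complexified.Rpow (map (map_prod \<iota> \<iota>) qs) (\<iota> z) (\<iota> w)
        = of_real (Rpow qs z w)" for z w
      using less[of qs] Cons by simp
    show ?thesis
      by (simp add: Cons complexified_curv IH IH' cong: sum.cong_simp)
  qed
qed

lemma complex_linear_form_eq_0:
  assumes f: "complexified.linear_form f" and "\<And>v. f (\<iota> v) = 0" shows "f u = 0"
proof -
  have "u = \<iota> (fst u) + cscale \<i> (\<iota> (snd u))" by (simp add: \<iota>_def cscale_def)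
  then have "f u = f (\<iota> (fst u) + cscale \<i> (\<iota> (snd u)))" by simp
  also have "\<dots> = 0"
    unfolding complexified.linear_form_add[OF f] complexified.linear_form_scale[OF f] assms(2) by simp
  finally show ?thesis .
qed

text \<open>
  By multilinearity: the slots are made complex one after the other, each vector being a complex
  combination of its real and imaginary parts.
\<close>
lemma complexified_Rpow_eq_0:
  assumes van: "\<And>ps z w. length ps = p \<Longrightarrow> Rpow ps z w = 0" and "length ps = p"
  shows "complexified.Rpow ps z w = 0"
proof -
  have main: "\<forall>ps. length ps = p \<and> (\<forall>i. k \<le> i \<and> i < p \<longrightarrow> ps ! i \<in> range (map_prod \<iota> \<iota>)) \<longrightarrow>
      complexified.Rpow ps z w = 0" if "k \<le> p" for k
    using that
  proof (induction k)
    case 0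
    show ?case
    proof (intro allI impI)
      fix ps assume ps: "length ps = p \<and> (\<forall>i. 0 \<le> i \<and> i < p \<longrightarrow> ps ! i \<in> range (map_prod \<iota> \<iota>))"
      then have "set ps \<subseteq> range (map_prod \<iota> \<iota>)" by (metis in_set_conv_nth le0 subsetI)
      then have "\<exists>qs. ps = map (map_prod \<iota> \<iota>) qs" by (simp only: ex_map_conv subset_eq image_iff bex_UNIV)
      then obtain qs where qs: "ps = map (map_prod \<iota> \<iota>) qs" by blast
      have "complexified.Rpow ps (\<iota> a) (\<iota> b) = 0" for a b
        unfolding qs complexified_Rpow using van[of qs] ps qs by simp
      then have "complexified.Rpow ps (\<iota> a) w = 0" for a
        by (rule complex_linear_form_eq_0[OF complexified.linear_form_Rpow(2)])
      then show "complexified.Rpow ps z w = 0"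
        by (rule complex_linear_form_eq_0[OF complexified.linear_form_Rpow(1)])
    qed
  next
    case (Suc k)
    show ?case
    proof (intro allI impI)
      fix ps assume ps: "length ps = p \<and> (\<forall>i. Suc k \<le> i \<and> i < p \<longrightarrow> ps ! i \<in> range (map_prod \<iota> \<iota>))"
      then have k: "k < length ps" using Suc.prems by simp
      have "complexified.Rpow (ps[k := (\<iota> a, \<iota> b)]) z w = 0" for a b
      proof -
        have "(\<iota> a, \<iota> b) \<in> range (map_prod \<iota> \<iota>)" by (metis map_prod_simp rangeI)
        then have "\<forall>i. k \<le> i \<and> i < p \<longrightarrow> ps[k := (\<iota> a, \<iota> b)] ! i \<in> range (map_prod \<iota> \<iota>)"
          using ps k by (auto simp: nth_list_update)
        then show ?thesis using Suc ps by simp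
      qed
      then have "complexified.Rpow (ps[k := (\<iota> a, v)]) z w = 0" for a v
        by (rule complex_linear_form_eq_0[OF complexified.linear_form_Rpow_snd[OF k]])
      then have "complexified.Rpow (ps[k := (u, v)]) z w = 0" for u v
        by (rule complex_linear_form_eq_0[OF complexified.Rpow_pair(1)[OF k]])
      from this[of "fst (ps ! k)" "snd (ps ! k)"] show "complexified.Rpow ps z w = 0" by simp
    qed
  qed
  have "\<forall>i. p \<le> i \<and> i < p \<longrightarrow> ps ! i \<in> range (map_prod \<iota> \<iota>)"
    by (metis leD)
  then show ?thesis using main[OF order_refl] assms(2) by blast
qed

text \<open>
  On a totally isotropic plane the vectors \<open>a + ib\<close> and \<open>a - ib\<close> are orthogonal null eigenvectors of the
  complexified operator, with different eigenvalues.
\<close>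
theorem no_complex_eigenplane:
  assumes van: "\<And>ps z w. length ps = p \<Longrightarrow> Rpow ps z w = 0" and p: "p \<ge> 1"
    and Sa: "S a = \<alpha> *\<^sub>R a - \<beta> *\<^sub>R b" and Sb: "S b = \<beta> *\<^sub>R a + \<alpha> *\<^sub>R b" and \<beta>: "\<beta> \<noteq> 0"
    and a: "a \<noteq> 0" and h: "h a a = 0" "h b b = 0" "h a b = 0"
  shows False
proof -
  have ne: "Complex \<alpha> \<beta> \<noteq> 0" "Complex \<alpha> (- \<beta>) \<noteq> 0" using \<beta> by (simp_all add: complex_eq_iff)
  have S1: "map_prod S S (a, b) = cscale (Complex \<alpha> \<beta>) (a, b)"
    and S2: "map_prod S S (a, - b) = cscale (Complex \<alpha> (- \<beta>)) (a, - b)"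
    by (simp_all add: cscale_def Sa Sb S_simps)
  obtain s where s: "(a, - b) = cscale s (a, b)"
  proof (rule complexified.null_eigenvector_unique[OF S1 _ _ ne(1) _ p S2 ne(2)])
    show "complexified_form h (a, b) (a, b) = 0" "complexified_form h (a, b) (a, - b) = 0"
      using h h_sym[of b a] by (simp_all add: complexified_form_def complex_eq_iff h_simps)
    show "(a, b) \<noteq> 0" using a by (simp add: zero_prod_def)
  qed (use complexified_Rpow_eq_0[OF van] in auto)
  have "map_prod S S (a, - b) = cscale s (map_prod S S (a, b))"
    unfolding s by (rule complexified.S_scale)
  also have "\<dots> = cscale (Complex \<alpha> \<beta>) (a, - b)"
    unfolding s S1 by (simp add: mult.commute)
  finally have "\<beta> *\<^sub>R a = - (\<beta> *\<^sub>R a)" unfolding S2 by (simp add: cscale_def)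
  then have "(\<beta> + \<beta>) *\<^sub>R a = 0" unfolding scaleR_add_left by (simp only: eq_neg_iff_add_eq_0)
  then show False using \<beta> a by simp
qed

end

section \<open>Calculus of smooth maps\<close>

lemma Ck_on_Suc_differentiable: "Ck_on (Suc k) U f \<Longrightarrow> x \<in> U \<Longrightarrow> f differentiable at x"
  by simp

lemma Ck_on_cong:
  assumes "open U" "\<And>x. x \<in> U \<Longrightarrow> f x = g x" "Ck_on k U f"
  shows "Ck_on k U g"
  using assms(2,3)
proof (induction k arbitrary: f g)
  case 0 then show ?case by (simp cong: continuous_on_cong)
next
  case (Suc k)
  have diff: "f differentiable at x" if "x \<in> U" for x using Suc.prems(2) that by simp
  have "g differentiable at x" if "x \<in> U" for x
    using diff[OF that] has_derivative_transform_within_open[OF _ assms(1) that, of f _ UNIV g] Suc.prems(1)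
    unfolding differentiable_def by blast
  moreover have "frechet_derivative f (at x) = frechet_derivative g (at x)" if "x \<in> U" for x
    by (rule frechet_derivative_transform_within_open[OF diff[OF that] assms(1) that Suc.prems(1)])
  ultimately show ?case using Suc.IH[of "\<lambda>x. frechet_derivative f (at x) _"] Suc.prems(2) by simp
qed

lemma Ck_on_SucD: "Ck_on (Suc k) U f \<Longrightarrow> Ck_on k U f"
proof (induction k arbitrary: f)
  case 0
  then show ?case
    by (auto intro!: continuous_at_imp_continuous_on differentiable_imp_continuous_within)
next
  case (Suc k)
  then show ?case by (metis Ck_on.simps(2))
qed

lemma Ck_on_const: "Ck_on k U (\<lambda>x. c)"
  by (induction k arbitrary: c) simp_all

lemma Ck_on_add:
  assumes "open U" "Ck_on k U f" "Ck_on k U g" shows "Ck_on k U (\<lambda>x. f x + g x)"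
  using assms(2,3)
proof (induction k arbitrary: f g)
  case 0 then show ?case by (simp add: continuous_on_add)
next
  case (Suc k)
  have "((\<lambda>x. f x + g x) has_derivative
      (\<lambda>v. frechet_derivative f (at x) v + frechet_derivative g (at x) v)) (at x)" if "x \<in> U" for x
    using Suc.prems that by (intro has_derivative_add) (simp_all flip: frechet_derivative_works)
  note der = this frechet_derivative_at[OF this, symmetric]
  have "Ck_on k U (\<lambda>x. frechet_derivative (\<lambda>x. f x + g x) (at x) v)" for v
    by (rule Ck_on_cong[OF assms(1) _ Suc.IH[of "\<lambda>x. frechet_derivative f (at x) v"
        "\<lambda>x. frechet_derivative g (at x) v"]]) (use Suc.prems in \<open>simp_all add: der(2)\<close>)
  then show ?case using der(1) by (auto simp: differentiable_def)
qed

lemma Ck_on_sum: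
  assumes "open U" "\<And>i. i \<in> I \<Longrightarrow> Ck_on k U (f i)" shows "Ck_on k U (\<lambda>x. \<Sum>i\<in>I. f i x)"
  using assms(2)
  by (induction I rule: infinite_finite_induct) (simp_all add: Ck_on_const Ck_on_add[OF assms(1)])

lemma (in bounded_bilinear) Ck_on_bilinear:
  assumes "open U" "Ck_on k U f" "Ck_on k U g" shows "Ck_on k U (\<lambda>x. prod (f x) (g x))"
  using assms(2,3)
proof (induction k arbitrary: f g)
  case 0 then show ?case by (simp add: continuous_on)
next
  case (Suc k)
  have "((\<lambda>x. prod (f x) (g x)) has_derivative
      (\<lambda>v. prod (f x) (frechet_derivative g (at x) v) + prod (frechet_derivative f (at x) v) (g x))) (at x)"
    if "x \<in> U" for x
    using Suc.prems that by (intro FDERIV) (simp_all flip: frechet_derivative_works)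
  note der = this frechet_derivative_at[OF this, symmetric]
  have "Ck_on k U (\<lambda>x. prod (f x) (frechet_derivative g (at x) v)
      + prod (frechet_derivative f (at x) v) (g x))" for v
    using Suc.prems Suc.prems[THEN Ck_on_SucD] by (intro Ck_on_add assms(1) Suc.IH) auto
  then have "Ck_on k U (\<lambda>x. frechet_derivative (\<lambda>x. prod (f x) (g x)) (at x) v)" for v
    by (rule Ck_on_cong[OF assms(1), rotated]) (simp add: der(2))
  then show ?case using der(1) by (auto simp: differentiable_def)
qed

lemma frechet_derivative_expand:
  fixes g :: "'b::euclidean_space \<Rightarrow> 'c::real_normed_vector"
  assumes "g differentiable at y"
  shows "frechet_derivative g (at y) v = (\<Sum>b\<in>Basis. (v \<bullet> b) *\<^sub>R frechet_derivative g (at y) b)"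
proof -
  interpret linear "frechet_derivative g (at y)"
    by (rule linear_frechet_derivative[OF assms])
  have "frechet_derivative g (at y) v = frechet_derivative g (at y) (\<Sum>b\<in>Basis. (v \<bullet> b) *\<^sub>R b)"
    by (simp only: euclidean_representation)
  also have "\<dots> = (\<Sum>b\<in>Basis. (v \<bullet> b) *\<^sub>R frechet_derivative g (at y) b)"
    by (simp only: sum scale)
  finally show ?thesis .
qed

text \<open>
  The derivative of the outer map is expanded along a basis, so that the chain rule exhibits the
  derivative of the composition as a sum of products of maps covered by the induction hypothesis.
\<close>
lemma Ck_on_compose:
  fixes f :: "'a::real_normed_vector \<Rightarrow> 'b::euclidean_space"
  assumes "open U" "open V" "f ` U \<subseteq> V" "Ck_on k U f" "Ck_on k V g"
  shows "Ck_on k U (\<lambda>x. g (f x))"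
  using assms(4,5)
proof (induction k arbitrary: g)
  case 0 then show ?case using assms(3) by (auto intro: continuous_on_compose2)
next
  case (Suc k)
  have df: "f differentiable at x" if "x \<in> U" for x using Suc.prems that by simp
  have dg: "g differentiable at (f x)" if "x \<in> U" for x using Suc.prems assms(3) that by auto
  have "((\<lambda>x. g (f x)) has_derivative
      (\<lambda>v. frechet_derivative g (at (f x)) (frechet_derivative f (at x) v))) (at x)" if "x \<in> U" for x
    using diff_chain_at[of f "frechet_derivative f (at x)" x g "frechet_derivative g (at (f x))"]
      df[OF that] dg[OF that] by (simp add: frechet_derivative_works o_def)
  note der = this frechet_derivative_at[OF this, symmetric]
  have "Ck_on k U (\<lambda>x. \<Sum>b\<in>Basis. (frechet_derivative f (at x) v \<bullet> b) *\<^sub>R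
      frechet_derivative g (at (f x)) b)" for v
  proof (rule Ck_on_sum[OF assms(1)])
    fix b :: 'b
    have "Ck_on k U (\<lambda>x. frechet_derivative f (at x) v \<bullet> b)"
      by (rule bounded_bilinear.Ck_on_bilinear[OF bounded_bilinear_inner assms(1) _ Ck_on_const])
        (use Suc.prems in simp)
    moreover have "Ck_on k U (\<lambda>x. frechet_derivative g (at (f x)) b)"
      by (rule Suc.IH[OF Ck_on_SucD[OF Suc.prems(1)]]) (use Suc.prems in simp)
    ultimately show "Ck_on k U (\<lambda>x. (frechet_derivative f (at x) v \<bullet> b) *\<^sub>R
        frechet_derivative g (at (f x)) b)"
      by (rule bounded_bilinear.Ck_on_bilinear[OF bounded_bilinear_scaleR assms(1)])
  qed
  then have "Ck_on k U (\<lambda>x. frechet_derivative (\<lambda>x. g (f x)) (at x) v)" for v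
  proof (rule Ck_on_cong[OF assms(1), rotated])
    fix x assume x: "x \<in> U"
    show "(\<Sum>b\<in>Basis. (frechet_derivative f (at x) v \<bullet> b) *\<^sub>R frechet_derivative g (at (f x)) b)
        = frechet_derivative (\<lambda>x. g (f x)) (at x) v"
      unfolding der(2)[OF x] by (rule frechet_derivative_expand[OF dg[OF x], symmetric])
  qed
  then show ?case using der(1) by (auto simp: differentiable_def)
qed

lemma smooth_on_cong:
  "open U \<Longrightarrow> smooth_on U f \<Longrightarrow> (\<And>x. x \<in> U \<Longrightarrow> f x = g x) \<Longrightarrow> smooth_on U g"
  unfolding smooth_on_def using Ck_on_cong by blast

lemma smooth_on_const: "smooth_on U (\<lambda>x. c)"
  unfolding smooth_on_def using Ck_on_const by blast

lemma smooth_on_compose: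
  fixes f :: "'a::real_normed_vector \<Rightarrow> 'b::euclidean_space"
  shows "open U \<Longrightarrow> open V \<Longrightarrow> f ` U \<subseteq> V \<Longrightarrow> smooth_on U f \<Longrightarrow> smooth_on V g
    \<Longrightarrow> smooth_on U (\<lambda>x. g (f x))"
  unfolding smooth_on_def using Ck_on_compose by blast

lemma smooth_on_differentiable: "smooth_on U f \<Longrightarrow> x \<in> U \<Longrightarrow> f differentiable at x"
  unfolding smooth_on_def using Ck_on_Suc_differentiable by blast

lemma smooth_on_has_derivative:
  "smooth_on U f \<Longrightarrow> x \<in> U \<Longrightarrow> (f has_derivative frechet_derivative f (at x)) (at x)"
  using smooth_on_differentiable frechet_derivative_works by blast

lemma smooth_on_frechet_derivative:
  "smooth_on U f \<Longrightarrow> smooth_on U (\<lambda>x. frechet_derivative f (at x) v)"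
  unfolding smooth_on_def by (metis Ck_on.simps(2))

lemma smooth_on_continuous: "smooth_on U f \<Longrightarrow> continuous_on U f"
  unfolding smooth_on_def by (metis Ck_on.simps(1))

lemma smooth_on_inner:
  "open U \<Longrightarrow> smooth_on U f \<Longrightarrow> smooth_on U (\<lambda>x. f x \<bullet> c)"
  unfolding smooth_on_def
  using bounded_bilinear.Ck_on_bilinear[OF bounded_bilinear_inner] Ck_on_const by blast

definition second_derivative ::
  "('a::real_normed_vector \<Rightarrow> 'b::real_normed_vector) \<Rightarrow> 'a \<Rightarrow> 'a \<Rightarrow> 'a \<Rightarrow> 'b" where
  "second_derivative f x u v = frechet_derivative (\<lambda>q. frechet_derivative f (at q) v) (at x) u"

lemma has_derivative_frechet_derivative:
  assumes "smooth_on U f" "x \<in> U"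
  shows "((\<lambda>q. frechet_derivative f (at q) v) has_derivative (\<lambda>u. second_derivative f x u v)) (at x)"
  unfolding second_derivative_def
  using smooth_on_has_derivative[OF smooth_on_frechet_derivative[OF assms(1)] assms(2)] by simp

lemma has_real_derivative_line:
  fixes f :: "'a::real_normed_vector \<Rightarrow> real"
  assumes "f differentiable at (p + t *\<^sub>R u)"
  shows "((\<lambda>t. f (p + t *\<^sub>R u)) has_real_derivative frechet_derivative f (at (p + t *\<^sub>R u)) u) (at t)"
proof -
  have 1: "((\<lambda>t. p + t *\<^sub>R u) has_derivative (\<lambda>r. r *\<^sub>R u)) (at t)"
    by (auto intro!: derivative_eq_intros)
  have 2: "(f has_derivative frechet_derivative f (at (p + t *\<^sub>R u))) (at (p + t *\<^sub>R u))"
    using assms frechet_derivative_works by blast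
  have "((\<lambda>t. f (p + t *\<^sub>R u)) has_derivative
      (\<lambda>r. frechet_derivative f (at (p + t *\<^sub>R u)) (r *\<^sub>R u))) (at t)"
    using diff_chain_at[OF 1 2] by (simp add: o_def)
  then show ?thesis
    by (simp add: has_field_derivative_def linear_cmul[OF linear_frechet_derivative[OF assms]]
        mult_commute_abs)
qed

text \<open>
  The mean value theorem, applied first in the direction \<open>u\<close> and then in the direction \<open>v\<close>.
\<close>
lemma second_difference_mean_value:
  fixes f :: "'a::real_normed_vector \<Rightarrow> real"
  assumes "smooth_on U f" and s: "s > 0"
    and U: "\<And>a b. 0 \<le> a \<Longrightarrow> a \<le> s \<Longrightarrow> 0 \<le> b \<Longrightarrow> b \<le> s \<Longrightarrow> x + a *\<^sub>R u + b *\<^sub>R v \<in> U"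
  obtains a b where "0 \<le> a" "a \<le> s" "0 \<le> b" "b \<le> s"
    "f (x + s *\<^sub>R u + s *\<^sub>R v) - f (x + s *\<^sub>R u) - f (x + s *\<^sub>R v) + f x
      = s * s * second_derivative f (x + a *\<^sub>R u + b *\<^sub>R v) v u"
proof -
  let ?G = "\<lambda>q. frechet_derivative f (at q) u"
  have "\<exists>a>0. a < s \<and> (f (x + s *\<^sub>R u + s *\<^sub>R v) - f (x + s *\<^sub>R u)) - (f (x + 0 *\<^sub>R u + s *\<^sub>R v) - f (x + 0 *\<^sub>R u))
      = (s - 0) * (?G (x + a *\<^sub>R u + s *\<^sub>R v) - ?G (x + a *\<^sub>R u))"
  proof (rule MVT2[OF s])
    fix a assume a: "0 \<le> a" "a \<le> s"
    have "f differentiable at ((x + s *\<^sub>R v) + a *\<^sub>R u)" "f differentiable at (x + a *\<^sub>R u)"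
      using smooth_on_differentiable[OF assms(1) U[OF a, of s]]
        smooth_on_differentiable[OF assms(1) U[OF a, of 0]] s by (simp_all add: algebra_simps)
    from this[THEN has_real_derivative_line]
    show "((\<lambda>a. f (x + a *\<^sub>R u + s *\<^sub>R v) - f (x + a *\<^sub>R u)) has_real_derivative
        ?G (x + a *\<^sub>R u + s *\<^sub>R v) - ?G (x + a *\<^sub>R u)) (at a)"
      by (intro DERIV_diff) (simp_all add: algebra_simps)
  qed
  then obtain a where a: "0 < a" "a < s" and fa: "f (x + s *\<^sub>R u + s *\<^sub>R v) - f (x + s *\<^sub>R u) - f (x + s *\<^sub>R v) + f x
      = s * (?G (x + a *\<^sub>R u + s *\<^sub>R v) - ?G (x + a *\<^sub>R u))" by (auto simp: algebra_simps)
  have "\<exists>b>0. b < s \<and> ?G (x + a *\<^sub>R u + s *\<^sub>R v) - ?G (x + a *\<^sub>R u + 0 *\<^sub>R v)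
      = (s - 0) * second_derivative f (x + a *\<^sub>R u + b *\<^sub>R v) v u"
  proof (rule MVT2[OF s])
    fix b assume b: "0 \<le> b" "b \<le> s"
    have "x + a *\<^sub>R u + b *\<^sub>R v \<in> U" using U[of a b] a b by simp
    then show "((\<lambda>b. ?G (x + a *\<^sub>R u + b *\<^sub>R v)) has_real_derivative
        second_derivative f (x + a *\<^sub>R u + b *\<^sub>R v) v u) (at b)"
      unfolding second_derivative_def
      by (intro has_real_derivative_line smooth_on_differentiable[OF smooth_on_frechet_derivative[OF assms(1)]])
  qed
  then obtain b where "0 < b" "b < s" "?G (x + a *\<^sub>R u + s *\<^sub>R v) - ?G (x + a *\<^sub>R u)
      = s * second_derivative f (x + a *\<^sub>R u + b *\<^sub>R v) v u" by auto
  then show ?thesis using that[of a b] a fa by simp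
qed

text \<open>
  The second difference over a small parallelogram is symmetric in the two directions and equals,
  up to the factor \<open>s\<^sup>2\<close>, a value of either mixed derivative near \<open>x\<close>.
\<close>
lemma second_derivative_symmetric_real:
  fixes f :: "'a::real_normed_vector \<Rightarrow> real"
  assumes "open U" "smooth_on U f" "x \<in> U"
  shows "second_derivative f x u v = second_derivative f x v u"
proof (rule ccontr)
  let ?A = "\<lambda>q. second_derivative f q u v" and ?B = "\<lambda>q. second_derivative f q v u"
  assume ne: "?A x \<noteq> ?B x"
  define e where "e = dist (?A x) (?B x) / 2"
  have e: "e > 0" using ne by (simp add: e_def)
  have cont: "isCont ?A x" "isCont ?B x"
    using continuous_on_eq_continuous_at[OF assms(1)] assms(3)
      smooth_on_continuous[OF smooth_on_frechet_derivative[OF smooth_on_frechet_derivative[OF assms(2)]]]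
    unfolding second_derivative_def by blast+
  obtain d1 where d1: "d1 > 0" "\<And>q. dist q x < d1 \<Longrightarrow> dist (?A q) (?A x) < e"
    using cont(1) e unfolding continuous_at_eps_delta by (auto simp: dist_commute) 
  obtain d2 where d2: "d2 > 0" "\<And>q. dist q x < d2 \<Longrightarrow> dist (?B q) (?B x) < e"
    using cont(2) e unfolding continuous_at_eps_delta by (auto simp: dist_commute)
  obtain d3 where d3: "d3 > 0" "\<And>q. dist q x < d3 \<Longrightarrow> q \<in> U"
    using assms(1,3) unfolding open_dist by blast
  define d where "d = min d1 (min d2 d3)"
  define s where "s = d / (2 * (norm u + norm v + 1))"
  have d: "d > 0" using d1 d2 d3 by (simp add: d_def)
  have pos: "norm u + norm v + 1 > 0" by (smt (verit) norm_ge_zero)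
  have s: "s > 0" using d pos by (simp add: s_def)
  have near: "dist (x + a *\<^sub>R u' + b *\<^sub>R v') x < d"
    if "0 \<le> a" "a \<le> s" "0 \<le> b" "b \<le> s" "norm u' + norm v' = norm u + norm v" for a b u' v'
  proof -
    have "dist (x + a *\<^sub>R u' + b *\<^sub>R v') x = norm (a *\<^sub>R u' + b *\<^sub>R v')"
      by (simp add: dist_norm algebra_simps)
    also have "\<dots> \<le> a * norm u' + b * norm v'"
      using norm_triangle_ineq[of "a *\<^sub>R u'" "b *\<^sub>R v'"] that by simp
    also have "\<dots> \<le> s * norm u' + s * norm v'"
      using that by (intro add_mono mult_right_mono) auto
    also have "\<dots> = s * (norm u + norm v)" using that by (simp flip: distrib_left)
    also have "\<dots> \<le> s * (norm u + norm v + 1)" using s by simp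
    also have "\<dots> = d / 2" 
    proof -
      have "d / (2 * N) * N = d / 2" if "N > 0" for N :: real using that by simp
      from this[OF pos] show ?thesis by (simp only: s_def)
    qed
    also have "\<dots> < d" using d by simp
    finally show ?thesis .
  qed
  obtain a b where 1: "0 \<le> a" "a \<le> s" "0 \<le> b" "b \<le> s"
    "f (x + s *\<^sub>R u + s *\<^sub>R v) - f (x + s *\<^sub>R u) - f (x + s *\<^sub>R v) + f x
      = s * s * ?B (x + a *\<^sub>R u + b *\<^sub>R v)"
    by (rule second_difference_mean_value[OF assms(2) s, of x u v]) 
      (use near d3 in \<open>auto simp: d_def\<close>)
  obtain a' b' where 2: "0 \<le> a'" "a' \<le> s" "0 \<le> b'" "b' \<le> s"
    "f (x + s *\<^sub>R v + s *\<^sub>R u) - f (x + s *\<^sub>R v) - f (x + s *\<^sub>R u) + f x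
      = s * s * ?A (x + a' *\<^sub>R v + b' *\<^sub>R u)"
    by (rule second_difference_mean_value[OF assms(2) s, of x v u])
      (use near[of _ _ v u] d3 in \<open>auto simp: d_def add.commute\<close>)
  have "s * s * ?B (x + a *\<^sub>R u + b *\<^sub>R v) = s * s * ?A (x + a' *\<^sub>R v + b' *\<^sub>R u)"
    using 1(5) 2(5) by (simp add: algebra_simps)
  then have "?B (x + a *\<^sub>R u + b *\<^sub>R v) = ?A (x + a' *\<^sub>R v + b' *\<^sub>R u)" using s by simp
  moreover have "dist (?B (x + a *\<^sub>R u + b *\<^sub>R v)) (?B x) < e"
    using near[OF 1(1-4) refl] d2 by (simp add: d_def)
  moreover have "dist (?A (x + a' *\<^sub>R v + b' *\<^sub>R u)) (?A x) < e"
    using near[OF 2(1-4), of v u] d1 by (simp add: d_def add.commute)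
  ultimately have "dist (?A x) (?B x) < e + e"
    by (metis dist_commute dist_triangle_less_add)
  then show False by (simp add: e_def)
qed

lemma second_derivative_inner:
  fixes f :: "'a::real_normed_vector \<Rightarrow> 'b::real_inner"
  assumes "open U" "smooth_on U f" "x \<in> U"
  shows "second_derivative (\<lambda>q. f q \<bullet> e) x u v = second_derivative f x u v \<bullet> e"
proof -
  have 1: "frechet_derivative (\<lambda>q. f q \<bullet> e) (at q) v = frechet_derivative f (at q) v \<bullet> e" if "q \<in> U" for q
    using frechet_derivative_at[OF has_derivative_inner_left[OF smooth_on_has_derivative[OF assms(2) that], of e]]
    by metis
  have "((\<lambda>q. frechet_derivative (\<lambda>q. f q \<bullet> e) (at q) v) has_derivative
      (\<lambda>u. second_derivative f x u v \<bullet> e)) (at x)"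
    by (rule has_derivative_transform_within_open[OF has_derivative_inner_left[OF
        has_derivative_frechet_derivative[OF assms(2,3)]] assms(1,3)]) (simp add: 1)
  from frechet_derivative_at[OF this] show ?thesis
    unfolding second_derivative_def by metis
qed

lemma second_derivative_symmetric:
  fixes f :: "'a::real_normed_vector \<Rightarrow> 'b::euclidean_space"
  assumes "open U" "smooth_on U f" "x \<in> U"
  shows "second_derivative f x u v = second_derivative f x v u"
proof (rule euclidean_eqI)
  fix e :: 'b
  show "second_derivative f x u v \<bullet> e = second_derivative f x v u \<bullet> e"
    using second_derivative_symmetric_real[OF assms(1) smooth_on_inner[OF assms(1,2)] assms(3)]
    by (simp add: second_derivative_inner[OF assms])
qed

lemma linear_second_derivative_1:
  assumes "smooth_on U f" "x \<in> U"
  shows "linear (\<lambda>u. second_derivative f x u v)"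
  using has_derivative_frechet_derivative[OF assms] has_derivative_linear by blast

lemma linear_second_derivative_2:
  fixes f :: "'a::real_normed_vector \<Rightarrow> 'b::euclidean_space"
  assumes "open U" "smooth_on U f" "x \<in> U"
  shows "linear (second_derivative f x u)"
proof -
  have "second_derivative f x u = (\<lambda>v. second_derivative f x v u)"
    by (rule ext) (rule second_derivative_symmetric[OF assms])
  then show ?thesis using linear_second_derivative_1[OF assms(2,3), of u] by simp
qed

text \<open>
  The product rule for the derivative of \<open>f\<close> applied to a varying vector.
\<close>
lemma has_derivative_directional:
  fixes f :: "'a::euclidean_space \<Rightarrow> 'b::euclidean_space"
  assumes "open U" "smooth_on U f" "x \<in> U" and w: "(w has_derivative w') (at x)"
  shows "((\<lambda>q. frechet_derivative f (at q) (w q)) has_derivative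
    (\<lambda>u. second_derivative f x u (w x) + frechet_derivative f (at x) (w' u))) (at x)"
proof -
  let ?E = "\<lambda>q v. \<Sum>b\<in>Basis. (v \<bullet> b) *\<^sub>R frechet_derivative f (at q) b"
  have expand: "?E q v = frechet_derivative f (at q) v" if "q \<in> U" for q v
    by (rule frechet_derivative_expand[OF smooth_on_differentiable[OF assms(2) that], symmetric])
  have "((\<lambda>q. ?E q (w q)) has_derivative
      (\<lambda>u. \<Sum>b\<in>Basis. (w x \<bullet> b) *\<^sub>R second_derivative f x u b
        + (w' u \<bullet> b) *\<^sub>R frechet_derivative f (at x) b)) (at x)"
    by (intro has_derivative_sum has_derivative_scaleR has_derivative_inner_left w
        has_derivative_frechet_derivative[OF assms(2,3)])
  moreover have "(\<Sum>b\<in>Basis. (w x \<bullet> b) *\<^sub>R second_derivative f x u b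
      + (w' u \<bullet> b) *\<^sub>R frechet_derivative f (at x) b)
    = second_derivative f x u (w x) + frechet_derivative f (at x) (w' u)" for u
  proof -
    interpret linear "second_derivative f x u" by (rule linear_second_derivative_2[OF assms(1-3)])
    have "second_derivative f x u (w x) = second_derivative f x u (\<Sum>b\<in>Basis. (w x \<bullet> b) *\<^sub>R b)"
      by (simp only: euclidean_representation)
    also have "\<dots> = (\<Sum>b\<in>Basis. (w x \<bullet> b) *\<^sub>R second_derivative f x u b)"
      by (simp only: sum scale)
    finally show ?thesis by (simp only: sum.distrib expand[OF assms(3)])
  qed
  ultimately have "((\<lambda>q. ?E q (w q)) has_derivative
    (\<lambda>u. second_derivative f x u (w x) + frechet_derivative f (at x) (w' u))) (at x)"
    by (simp only:)
  then show ?thesis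
    by (rule has_derivative_transform_within_open[OF _ assms(1,3)]) (rule expand)
qed

section \<open>Coordinates on a manifold\<close>

definition transition ::
  "('a, 'm::finite) chart \<Rightarrow> ('a, 'm) chart \<Rightarrow> real^'m \<Rightarrow> real^'m" where
  "transition c d = snd d \<circ> chart_inv c"

text \<open>
  The Jacobian of the change of coordinates from \<open>c\<close> to \<open>d\<close>, at a point of the manifold.
\<close>
definition jac :: "('a, 'm::finite) chart \<Rightarrow> ('a, 'm) chart \<Rightarrow> 'a \<Rightarrow> real^'m \<Rightarrow> real^'m" where
  "jac c d y = frechet_derivative (transition c d) (at (snd c y))"

text \<open>
  The vector field with constant components \<open>v\<close> in the chart \<open>c\<close>. At a fixed point of \<open>c\<close> it
  parametrizes the tangent space linearly by \<open>v\<close>.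
\<close>
definition coordinate_field ::
  "('a, 'm::finite) chart set \<Rightarrow> ('a, 'm) chart \<Rightarrow> real^'m \<Rightarrow> ('a, 'm) vfield" where
  "coordinate_field A c v = (\<lambda>y d. if c \<in> charts_at A y \<and> d \<in> charts_at A y then jac c d y v else 0)"

locale atlas =
  fixes M :: "'a topology" and A :: "('a, 'm::finite) chart set"
  assumes smooth_atlas: "smooth_atlas M A"
begin

lemma openin_chart: "c \<in> A \<Longrightarrow> openin M (fst c)"
  using smooth_atlas unfolding smooth_atlas_def is_chart_def by blast

lemma chart_subset: "c \<in> A \<Longrightarrow> fst c \<subseteq> topspace M"
  using openin_chart openin_subset by blast

lemma homeomorphic_chart:
  "c \<in> A \<Longrightarrow> homeomorphic_map (subtopology M (fst c)) (top_of_set (snd c ` fst c)) (snd c)"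
  using smooth_atlas unfolding smooth_atlas_def is_chart_def by blast

lemma inj_on_chart: "c \<in> A \<Longrightarrow> inj_on (snd c) (fst c)"
  using homeomorphic_imp_injective_map[OF homeomorphic_chart, of c] chart_subset[of c]
  by (simp add: Int_absorb1)

lemma chart_inv: "c \<in> A \<Longrightarrow> y \<in> fst c \<Longrightarrow> chart_inv c (snd c y) = y"
  unfolding chart_inv_def using inj_on_chart by (simp add: inv_into_f_f)

lemma open_chart_image:
  assumes "c \<in> A" "openin M W" shows "open (snd c ` (fst c \<inter> W))"
proof -
  have "openin (subtopology M (fst c)) (fst c \<inter> W)"
    using assms(2) by (simp add: openin_subtopology_Int2)
  then have "openin (top_of_set (snd c ` fst c)) (snd c ` (fst c \<inter> W))"
    using homeomorphic_imp_open_map[OF homeomorphic_chart[OF assms(1)]] unfolding open_map_def by blast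
  moreover have "open (snd c ` fst c)"
    using assms(1) smooth_atlas unfolding smooth_atlas_def is_chart_def by blast
  ultimately show ?thesis using openin_open_trans by blast
qed

lemma open_chart_range: "c \<in> A \<Longrightarrow> open (snd c ` fst c)"
  using open_chart_image[of c "topspace M"] chart_subset[of c] by (simp add: Int_absorb2)

lemma open_overlap: "c \<in> A \<Longrightarrow> d \<in> A \<Longrightarrow> open (snd c ` (fst c \<inter> fst d))"
  by (intro open_chart_image openin_chart)

lemma smooth_transition:
  "c \<in> A \<Longrightarrow> d \<in> A \<Longrightarrow> smooth_on (snd c ` (fst c \<inter> fst d)) (transition c d)"
  using smooth_atlas unfolding smooth_atlas_def transition_def by blast

lemma transition_at: "c \<in> A \<Longrightarrow> y \<in> fst c \<Longrightarrow> transition c d (snd c y) = snd d y"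
  by (simp add: transition_def chart_inv)

lemma has_derivative_transition:
  assumes "c \<in> A" "d \<in> A" "y \<in> fst c" "y \<in> fst d"
  shows "(transition c d has_derivative jac c d y) (at (snd c y))"
  unfolding jac_def
  by (intro smooth_on_has_derivative[OF smooth_transition[OF assms(1,2)]]) (use assms in blast)

lemma jac_cocycle:
  assumes A: "c \<in> A" "d \<in> A" "e \<in> A" and y: "y \<in> fst c" "y \<in> fst d" "y \<in> fst e"
  shows "jac d e y (jac c d y v) = jac c e y v"
proof -
  let ?V = "snd c ` (fst c \<inter> (fst d \<inter> fst e))"
  have "(transition d e \<circ> transition c d has_derivative jac d e y \<circ> jac c d y) (at (snd c y))"
    using diff_chain_at[OF has_derivative_transition[OF A(1,2) y(1,2)], of "transition d e" "jac d e y"]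
      has_derivative_transition[OF A(2,3) y(2,3)] transition_at[OF A(1) y(1), of d] by simp
  moreover have "open ?V" using A by (intro open_chart_image openin_Int openin_chart)
  moreover have "(transition d e \<circ> transition c d) q = transition c e q" if "q \<in> ?V" for q
    using that A by (auto simp: transition_at)
  ultimately have "(transition c e has_derivative jac d e y \<circ> jac c d y) (at (snd c y))"
    using has_derivative_transform_within_open[of _ _ _ UNIV ?V "transition c e"] y by blast
  from has_derivative_unique[OF this has_derivative_transition[OF A(1,3) y(1,3)]]
  show ?thesis by (metis comp_apply)
qed

lemma jac_same:
  assumes "c \<in> A" "y \<in> fst c" shows "jac c c y v = v"
proof -
  have "(transition c c has_derivative (\<lambda>v. v)) (at (snd c y))"
    by (rule has_derivative_transform_within_open[OF has_derivative_ident open_chart_range[OF assms(1)]])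
      (use assms in \<open>auto simp: transition_at\<close>)
  from has_derivative_unique[OF this has_derivative_transition[OF assms(1,1) assms(2,2)]]
  show ?thesis by metis
qed

lemma linear_jac:
  assumes "c \<in> A" "d \<in> A" "y \<in> fst c" "y \<in> fst d" shows "linear (jac c d y)"
  using has_derivative_linear[OF has_derivative_transition[OF assms]] .

lemma coordinate_field_tangent:
  "c \<in> A \<Longrightarrow> y \<in> fst c \<Longrightarrow> coordinate_field A c v y \<in> tangent_space A y"
  by (auto simp: tangent_space_def coordinate_field_def charts_at_def jac_cocycle
      simp flip: transition_def jac_def)

lemma coordinate_field_at [simp]: "c \<in> A \<Longrightarrow> y \<in> fst c \<Longrightarrow> coordinate_field A c v y c = v"
  by (simp add: coordinate_field_def charts_at_def jac_same)

lemma tangent_vector_eq: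
  assumes "c \<in> A" "y \<in> fst c" "v \<in> tangent_space A y"
  shows "v = coordinate_field A c (v c) y"
proof (rule ext)
  fix d
  show "v d = coordinate_field A c (v c) y d"
  proof (cases "d \<in> charts_at A y")
    case True
    moreover have "c \<in> charts_at A y" using assms by (simp add: charts_at_def)
    moreover from calculation have "v d = jac c d y (v c)"
      using assms(3) unfolding tangent_space_def jac_def transition_def by blast
    ultimately show ?thesis by (simp only: coordinate_field_def simp_thms if_True)
  next
    case False
    then have "v d = 0" using assms(3) unfolding tangent_space_def by blast
    then show ?thesis using False by (simp add: coordinate_field_def)
  qed
qed

lemma coordinate_field_add:
  "coordinate_field A c (u + v) y = coordinate_field A c u y + coordinate_field A c v y"
proof (rule ext)
  fix d
  show "coordinate_field A c (u + v) y d = (coordinate_field A c u y + coordinate_field A c v y) d"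
    using linear_add[OF linear_jac[of c d y], of u v] by (simp add: coordinate_field_def charts_at_def)
qed

lemma coordinate_field_scale:
  "coordinate_field A c (r *\<^sub>R v) y = r *\<^sub>R coordinate_field A c v y"
proof (rule ext)
  fix d
  show "coordinate_field A c (r *\<^sub>R v) y d = (r *\<^sub>R coordinate_field A c v y) d"
    using linear_cmul[OF linear_jac[of c d y], of r v]
    by (simp add: coordinate_field_def charts_at_def scaleR_fun_def)
qed

lemma coordinate_field_diff:
  "coordinate_field A c (u - v) y = coordinate_field A c u y - coordinate_field A c v y"
proof (rule ext)
  fix d
  show "coordinate_field A c (u - v) y d = (coordinate_field A c u y - coordinate_field A c v y) d"
    using linear_diff[OF linear_jac[of c d y], of u v] by (simp add: coordinate_field_def charts_at_def)
qed

lemma coordinate_field_0 [simp]: "coordinate_field A c 0 y = 0"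
  using coordinate_field_diff[of c 0 0 y] by simp

lemma coordinate_field_in_chart:
  assumes "c \<in> A" "d \<in> A" "q \<in> snd d ` (fst d \<inter> fst c)"
  shows "coordinate_field A c v (chart_inv d q) d
    = frechet_derivative (transition c d) (at (transition d c q)) v"
  using assms by (auto simp: coordinate_field_def charts_at_def jac_def chart_inv transition_at)

lemma coordinate_field_vector_field:
  assumes c: "c \<in> A" shows "coordinate_field A c v \<in> vector_fields A (fst c)"
  unfolding vector_fields_def
proof (intro CollectI conjI ballI)
  fix d assume d: "d \<in> A"
  let ?V = "snd d ` (fst d \<inter> fst c)"
  have "smooth_on ?V (\<lambda>q. frechet_derivative (transition c d) (at (transition d c q)) v)"
  proof (rule smooth_on_compose[OF open_overlap[OF d c] open_overlap[OF c d],
        where f = "transition d c" and g = "\<lambda>q. frechet_derivative (transition c d) (at q) v"])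
    show "transition d c ` ?V \<subseteq> snd c ` (fst c \<inter> fst d)"
      using d by (auto simp: transition_at)
  qed (rule smooth_transition[OF d c] smooth_on_frechet_derivative[OF smooth_transition[OF c d]])+
  then show "smooth_on ?V (\<lambda>q. coordinate_field A c v (chart_inv d q) d)"
    by (rule smooth_on_cong[OF open_overlap[OF d c]]) (simp add: coordinate_field_in_chart[OF c d])
qed (simp add: coordinate_field_tangent c)

text \<open>
  The chart used in the definition of the derivative is arbitrary; the chain rule for the change of
  coordinates allows any other chart.
\<close>
lemma tan_deriv_chart:
  assumes c: "c \<in> A" and y: "y \<in> fst c" and v: "v \<in> tangent_space A y"
    and G: "(G \<circ> chart_inv c has_derivative G') (at (snd c y))"
  shows "tan_deriv A G y v = G' (v c)"
proof -
  define d where "d = (SOME c. c \<in> charts_at A y)"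
  have "d \<in> charts_at A y" unfolding d_def by (rule someI[of _ c]) (use c y in \<open>simp add: charts_at_def\<close>)
  then have d: "d \<in> A" "y \<in> fst d" by (auto simp: charts_at_def)
  have "((G \<circ> chart_inv c) \<circ> transition d c has_derivative G' \<circ> jac d c y) (at (snd d y))"
    using diff_chain_at[OF has_derivative_transition[OF d(1) c d(2) y], of "G \<circ> chart_inv c" G'] G
    by (simp add: transition_at[OF d])
  then have "(G \<circ> chart_inv d has_derivative G' \<circ> jac d c y) (at (snd d y))"
    by (rule has_derivative_transform_within_open[OF _ open_overlap[OF d(1) c]])
      (use d y c in \<open>auto simp: transition_at chart_inv\<close>)
  from frechet_derivative_at[OF this]
  have "tan_deriv A G y v = G' (jac d c y (v d))"
    by (simp add: tan_deriv_def d_def[symmetric] flip: comp_apply[of G'])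
  moreover have "jac d c y (v d) = v c"
  proof -
    have "c \<in> charts_at A y" "d \<in> charts_at A y" using c y d by (simp_all add: charts_at_def)
    then have "v c = jac d c y (v d)"
      using v unfolding tangent_space_def jac_def transition_def by blast
    then show ?thesis by (rule sym)
  qed
  ultimately show ?thesis by simp
qed

lemma has_derivative_vector_field:
  assumes "c \<in> A" "X \<in> vector_fields A (fst c)" "q \<in> snd c ` fst c"
  shows "((\<lambda>q. X (chart_inv c q) c) has_derivative
    frechet_derivative (\<lambda>q. X (chart_inv c q) c) (at q)) (at q)"
  by (rule smooth_on_has_derivative[of "snd c ` (fst c \<inter> fst c)"])
    (use assms in \<open>auto simp: vector_fields_def\<close>)

text \<open>
  In another chart \<open>d\<close> the bracket is the difference of two mixed second derivatives of the change of
  coordinates.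
\<close>
lemma lie_bracket_coordinate_fields:
  assumes c: "c \<in> A" and y: "y \<in> fst c"
  shows "lie_bracket A (coordinate_field A c u) (coordinate_field A c v) y = 0"
proof (rule ext)
  fix d
  show "lie_bracket A (coordinate_field A c u) (coordinate_field A c v) y d = 0 d"
  proof (cases "d \<in> charts_at A y")
    case True
    then have d: "d \<in> A" "y \<in> fst d" by (auto simp: charts_at_def)
    let ?T = "transition c d"
    have *: "frechet_derivative (\<lambda>q. coordinate_field A c v (chart_inv d q) d) (at (snd d y))
        (coordinate_field A c u y d) = second_derivative ?T (snd c y) u v" for u v
    proof -
      let ?X = "\<lambda>q. coordinate_field A c v (chart_inv d q) d"
      have "smooth_on (snd d ` (fst d \<inter> fst c)) ?X"
        using coordinate_field_vector_field[OF c] d by (simp add: vector_fields_def)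
      then have "(?X has_derivative frechet_derivative ?X (at (snd d y))) (at (snd d y))"
        by (rule smooth_on_has_derivative) (use d y in blast)
      then have "(?X \<circ> ?T has_derivative frechet_derivative ?X (at (snd d y)) \<circ> jac c d y) (at (snd c y))"
        using diff_chain_at[OF has_derivative_transition[OF c d(1) y d(2)], of ?X] 
        by (simp add: transition_at[OF c y])
      then have "((\<lambda>q. frechet_derivative ?T (at q) v) has_derivative
          frechet_derivative ?X (at (snd d y)) \<circ> jac c d y) (at (snd c y))"
      proof (rule has_derivative_transform_within_open[OF _ open_overlap[OF c d(1)]])
        fix q assume "q \<in> snd c ` (fst c \<inter> fst d)"
        then obtain z where z: "q = snd c z" "z \<in> fst c" "z \<in> fst d" by blast
        then show "(?X \<circ> ?T) q = frechet_derivative ?T (at q) v"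
          using coordinate_field_in_chart[OF c d(1), of "snd d z" v] c d by (simp add: transition_at)
      qed (use y d in blast)
      from fun_cong[OF frechet_derivative_at[OF this], of u] show ?thesis
        using c y d by (simp add: second_derivative_def coordinate_field_def charts_at_def)
    qed
    have "second_derivative ?T (snd c y) u v = second_derivative ?T (snd c y) v u"
      by (rule second_derivative_symmetric[OF open_overlap[OF c d(1)] smooth_transition[OF c d(1)]])
        (use y d in blast)
    then show ?thesis using True * by (simp add: lie_bracket_def)
  qed (simp add: lie_bracket_def)
qed

lemma vector_fields_eq_0:
  assumes c: "c \<in> A" and X: "\<And>y. y \<in> fst c \<Longrightarrow> X y = 0"
  shows "X \<in> vector_fields A (fst c)"
  unfolding vector_fields_def
proof (intro CollectI conjI ballI)
  fix y assume "y \<in> fst c"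
  then show "X y \<in> tangent_space A y" using X coordinate_field_tangent[OF c, of y 0] by simp
next
  fix d assume d: "d \<in> A"
  show "smooth_on (snd d ` (fst d \<inter> fst c)) (\<lambda>q. X (chart_inv d q) d)"
    by (rule smooth_on_cong[OF open_overlap[OF d c] smooth_on_const[of _ 0]])
      (use d in \<open>auto simp: chart_inv X\<close>)
qed

end

section \<open>The Gauss equation\<close>

locale affine_hypersurface = atlas M A
  for M :: "'a topology" and A :: "('a, 'm::finite) chart set" +
  fixes f \<xi> :: "'a \<Rightarrow> 'b::euclidean_space"
    and nab :: "('a, 'm) vfield \<Rightarrow> ('a, 'm) vfield \<Rightarrow> ('a, 'm) vfield"
    and h :: "'a \<Rightarrow> ('a, 'm) tvec \<Rightarrow> ('a, 'm) tvec \<Rightarrow> real"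
    and S :: "'a \<Rightarrow> ('a, 'm) tvec \<Rightarrow> ('a, 'm) tvec"
    and \<tau> :: "'a \<Rightarrow> ('a, 'm) tvec \<Rightarrow> real"
  assumes immersion: "immersion M A f"
    and transversal: "transversal_field M A f \<xi>"
    and induced: "induced_by M A f \<xi> nab h S \<tau>"
begin

context
  fixes c :: "('a, 'm) chart"
  assumes c: "c \<in> A"
begin

abbreviation F where "F \<equiv> f \<circ> chart_inv c"
abbreviation DF where "DF \<equiv> \<lambda>q. frechet_derivative F (at q)"
abbreviation \<Xi> where "\<Xi> \<equiv> \<xi> \<circ> chart_inv c"
abbreviation E where "E \<equiv> coordinate_field A c"

lemma open_range: "open (snd c ` fst c)"
  by (rule open_chart_range[OF c])

lemma smooth_F: "smooth_on (snd c ` fst c) F" and smooth_\<Xi>: "smooth_on (snd c ` fst c) \<Xi>"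
proof -
  have "fst c \<inter> topspace M = fst c" using chart_subset[OF c] by blast
  then show "smooth_on (snd c ` fst c) F" "smooth_on (snd c ` fst c) \<Xi>"
    using immersion transversal c unfolding immersion_def transversal_field_def smooth_map_on_def
    by metis+
qed

lemma DF_has_derivative: "y \<in> fst c \<Longrightarrow> (F has_derivative DF (snd c y)) (at (snd c y))"
  by (rule smooth_on_has_derivative[OF smooth_F]) simp

lemma linear_DF: "y \<in> fst c \<Longrightarrow> linear (DF (snd c y))"
  using DF_has_derivative has_derivative_linear by blast

lemma tan_deriv_f:
  "y \<in> fst c \<Longrightarrow> v \<in> tangent_space A y \<Longrightarrow> tan_deriv A f y v = DF (snd c y) (v c)"
  by (rule tan_deriv_chart[OF c _ _ DF_has_derivative])

text \<open>
  Transversality and injectivity together: tangential and transversal components are unique. All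
  linearity statements and the Gauss equation are obtained by comparing components.
\<close>
lemma DF_eq_transversal:
  assumes x: "x \<in> fst c" and eq: "DF (snd c x) w = t *\<^sub>R \<xi> x"
  shows "w = 0" and "t = 0"
proof -
  have M: "x \<in> topspace M" using x chart_subset[OF c] by blast
  interpret linear "DF (snd c x)" by (rule linear_DF[OF x])
  have E: "E v x \<in> tangent_space A x" "tan_deriv A f x (E v x) = DF (snd c x) v" for v
    using coordinate_field_tangent[OF c x] tan_deriv_f[OF x] c x by simp_all
  show t: "t = 0"
  proof (rule ccontr)
    assume "t \<noteq> 0"
    then have "\<xi> x = DF (snd c x) ((1 / t) *\<^sub>R w)" by (simp add: scale eq)
    then have "\<xi> x \<in> tan_deriv A f x ` tangent_space A x" using E by (metis image_eqI)
    then show False using transversal M unfolding transversal_field_def by blast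
  qed
  have "tan_deriv A f x (E w x) = tan_deriv A f x (E 0 x)" 
    unfolding E(2) eq t zero by simp
  then have "E w x = E 0 x"
    using immersion M E(1) unfolding immersion_def inj_on_def by blast
  then show "w = 0" using coordinate_field_at[OF c x] by metis
qed

lemma \<xi>_nonzero: "x \<in> fst c \<Longrightarrow> \<xi> x \<noteq> 0"
  using DF_eq_transversal(2)[of x 0 1] linear_0[OF linear_DF, of x] by auto

lemma induced_chart:
  assumes "X \<in> vector_fields A (fst c)" "Y \<in> vector_fields A (fst c)"
  shows "nab X Y \<in> vector_fields A (fst c)"
    and "x \<in> fst c \<Longrightarrow> tan_deriv A (\<lambda>y. tan_deriv A f y (Y y)) x (X x)
      = tan_deriv A f x (nab X Y x) + h x (X x) (Y x) *\<^sub>R \<xi> x"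
    and "x \<in> fst c \<Longrightarrow> tan_deriv A \<xi> x (X x)
      = - tan_deriv A f x (S x (X x)) + \<tau> x (X x) *\<^sub>R \<xi> x"
  using induced openin_chart[OF c] assms unfolding induced_by_def by blast+

lemma vector_field_tangent: "X \<in> vector_fields A U \<Longrightarrow> x \<in> U \<Longrightarrow> X x \<in> tangent_space A x"
  unfolding vector_fields_def by blast

text \<open>
  The formula of Gauss, read in coordinates.
\<close>
lemma gauss_formula:
  assumes X: "X \<in> vector_fields A (fst c)" and Y: "Y \<in> vector_fields A (fst c)" and x: "x \<in> fst c"
  shows "second_derivative F (snd c x) (X x c) (Y x c)
      + DF (snd c x) (frechet_derivative (\<lambda>q. Y (chart_inv c q) c) (at (snd c x)) (X x c))
    = DF (snd c x) (nab X Y x c) + h x (X x) (Y x) *\<^sub>R \<xi> x"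
proof -
  let ?Y = "\<lambda>q. Y (chart_inv c q) c"
  have p: "snd c x \<in> snd c ` fst c" using x by blast
  have "((\<lambda>q. DF q (?Y q)) has_derivative (\<lambda>u. second_derivative F (snd c x) u (?Y (snd c x))
      + DF (snd c x) (frechet_derivative ?Y (at (snd c x)) u))) (at (snd c x))"
    by (rule has_derivative_directional[OF open_range smooth_F p has_derivative_vector_field[OF c Y p]])
  then have "((\<lambda>y. tan_deriv A f y (Y y)) \<circ> chart_inv c has_derivative
      (\<lambda>u. second_derivative F (snd c x) u (?Y (snd c x))
      + DF (snd c x) (frechet_derivative ?Y (at (snd c x)) u))) (at (snd c x))"
    by (rule has_derivative_transform_within_open[OF _ open_range p])
      (auto simp: chart_inv[OF c] tan_deriv_f vector_field_tangent[OF Y])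
  from tan_deriv_chart[OF c x vector_field_tangent[OF X x] this]
  show ?thesis
    using induced_chart(2)[OF X Y x] tan_deriv_f[OF x vector_field_tangent[OF induced_chart(1)[OF X Y] x]]
    by (simp add: chart_inv[OF c x])
qed

lemma E_field: "E v \<in> vector_fields A (fst c)"
  by (rule coordinate_field_vector_field[OF c])

lemma E_constant: "frechet_derivative (\<lambda>q. E v (chart_inv c q) c) (at (snd c x)) u = 0" if x: "x \<in> fst c"
proof -
  have "((\<lambda>q. E v (chart_inv c q) c) has_derivative (\<lambda>u. 0)) (at (snd c x))"
    by (rule has_derivative_transform_within_open[OF has_derivative_const open_range])
      (use x c in \<open>auto simp: chart_inv\<close>)
  from frechet_derivative_at[OF this] show ?thesis by metis
qed

definition \<Gamma> where "\<Gamma> v w x = nab (E v) (E w) x c"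
definition H where "H v w x = h x (E v x) (E w x)"

lemma gauss_formula_coordinate:
  assumes x: "x \<in> fst c"
  shows "second_derivative F (snd c x) v w = DF (snd c x) (\<Gamma> v w x) + H v w x *\<^sub>R \<xi> x"
  using gauss_formula[OF E_field E_field x, of v w] x c
  by (simp add: E_constant \<Gamma>_def H_def linear_0[OF linear_DF])

lemma S_tangent: "x \<in> fst c \<Longrightarrow> v \<in> tangent_space A x \<Longrightarrow> S x v \<in> tangent_space A x"
  using induced chart_subset[OF c] unfolding induced_by_def by blast

definition shape where "shape v x = S x (E v x) c"

lemma weingarten_formula:
  assumes x: "x \<in> fst c"
  shows "frechet_derivative \<Xi> (at (snd c x)) v
    = - DF (snd c x) (shape v x) + \<tau> x (E v x) *\<^sub>R \<xi> x"
proof -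
  have "(\<Xi> has_derivative frechet_derivative \<Xi> (at (snd c x))) (at (snd c x))"
    using smooth_on_has_derivative[OF smooth_\<Xi>] x by blast
  from tan_deriv_chart[OF c x coordinate_field_tangent[OF c x] this]
  show ?thesis
    using induced_chart(3)[OF E_field[of v] E_field[of v] x] 
      tan_deriv_f[OF x S_tangent[OF x coordinate_field_tangent[OF c x]]] x c
    by (simp add: shape_def)
qed

lemma H_sym: assumes x: "x \<in> fst c" shows "H v w x = H w v x"
proof -
  have "second_derivative F (snd c x) v w = second_derivative F (snd c x) w v"
    by (rule second_derivative_symmetric[OF open_range smooth_F]) (use x in blast)
  then have "DF (snd c x) (\<Gamma> v w x - \<Gamma> w v x) = (H w v x - H v w x) *\<^sub>R \<xi> x"
    by (simp add: gauss_formula_coordinate[OF x] linear_diff[OF linear_DF[OF x]] linear_add[OF linear_DF[OF x]]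
          algebra_simps)
  from DF_eq_transversal(2)[OF x this] show ?thesis by simp
qed

lemma linear_H: assumes x: "x \<in> fst c" shows "linear (\<lambda>v. H v w x)"
proof -
  have p: "snd c x \<in> snd c ` fst c" using x by blast
  note lin = linear_second_derivative_1[OF smooth_F p, of w]
  show ?thesis
  proof (rule linearI)
    fix u v
    have "DF (snd c x) (\<Gamma> (u + v) w x - \<Gamma> u w x - \<Gamma> v w x)
        = (H u w x + H v w x - H (u + v) w x) *\<^sub>R \<xi> x"
      using linear_add[OF lin, of u v]
      by (simp add: gauss_formula_coordinate[OF x] linear_diff[OF linear_DF[OF x]] linear_add[OF linear_DF[OF x]]
          algebra_simps)
    from DF_eq_transversal(2)[OF x this] show "H (u + v) w x = H u w x + H v w x" by simp
  next
    fix r v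
    have "DF (snd c x) (\<Gamma> (r *\<^sub>R v) w x - r *\<^sub>R \<Gamma> v w x)
        = (r * H v w x - H (r *\<^sub>R v) w x) *\<^sub>R \<xi> x"
      using linear_cmul[OF lin, of r v]
      by (simp add: gauss_formula_coordinate[OF x] linear_diff[OF linear_DF[OF x]]
          linear_cmul[OF linear_DF[OF x]] algebra_simps)
    from DF_eq_transversal(2)[OF x this] show "H (r *\<^sub>R v) w x = r *\<^sub>R H v w x" by simp
  qed
qed

lemma linear_shape: assumes x: "x \<in> fst c" shows "linear (\<lambda>v. shape v x)"
proof -
  have lin: "linear (frechet_derivative \<Xi> (at (snd c x)))"
    using smooth_on_differentiable[OF smooth_\<Xi>] x by (intro linear_frechet_derivative) blast
  show ?thesis
  proof (rule linearI)
    fix u v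
    have "DF (snd c x) (shape (u + v) x - shape u x - shape v x)
        = (\<tau> x (E (u + v) x) - \<tau> x (E u x) - \<tau> x (E v x)) *\<^sub>R \<xi> x"
      using linear_add[OF lin, of u v]
      by (simp add: weingarten_formula[OF x] linear_diff[OF linear_DF[OF x]] linear_add[OF linear_DF[OF x]]
          algebra_simps)
    from DF_eq_transversal(1)[OF x this] show "shape (u + v) x = shape u x + shape v x"
      by (simp add: algebra_simps)
  next
    fix r v
    have "DF (snd c x) (shape (r *\<^sub>R v) x - r *\<^sub>R shape v x)
        = (\<tau> x (E (r *\<^sub>R v) x) - r * \<tau> x (E v x)) *\<^sub>R \<xi> x"
      using linear_cmul[OF lin, of r v]
      by (simp add: weingarten_formula[OF x] linear_diff[OF linear_DF[OF x]]
          linear_cmul[OF linear_DF[OF x]] algebra_simps)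
    from DF_eq_transversal(1)[OF x this] show "shape (r *\<^sub>R v) x = r *\<^sub>R shape v x" by simp
  qed
qed

text \<open>
  The left-hand side is the third derivative of \<open>F\<close> in the directions \<open>u\<close>, \<open>v\<close>, \<open>w\<close>. It is computed by
  differentiating the formula of Gauss for \<open>(v, w)\<close> in the direction \<open>u\<close>; the derivative of \<open>\<xi>\<close>
  contributes the shape operator. Only the tangential part matters later, so the transversal
  coefficient is left unspecified.
\<close>
lemma third_derivative:
  assumes x: "x \<in> fst c"
  obtains t where "second_derivative (\<lambda>q. DF q w) (snd c x) u v
    = DF (snd c x) (nab (E u) (nab (E v) (E w)) x c - H v w x *\<^sub>R shape u x) + t *\<^sub>R \<xi> x"
proof -
  let ?p = "snd c x" and ?Z = "nab (E v) (E w)"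
  let ?\<Gamma> = "\<lambda>q. ?Z (chart_inv c q) c"
  let ?G = "\<lambda>q. second_derivative F q v w"
  \<comment> \<open>The second fundamental form recovered from the formula of Gauss, to see that it is differentiable.\<close>
  let ?H = "\<lambda>q. ((?G q - DF q (?\<Gamma> q)) \<bullet> \<Xi> q) / (\<Xi> q \<bullet> \<Xi> q)"
  have p: "?p \<in> snd c ` fst c" using x by blast
  have Z: "?Z \<in> vector_fields A (fst c)" by (rule induced_chart(1)[OF E_field E_field])
  have G: "(?G has_derivative (\<lambda>u. second_derivative (\<lambda>q. DF q w) ?p u v)) (at ?p)"
    unfolding second_derivative_def
    using smooth_on_has_derivative[OF smooth_on_frechet_derivative[OF smooth_on_frechet_derivative[OF smooth_F]] p]
    by simp
  have D\<Gamma>: "((\<lambda>q. DF q (?\<Gamma> q)) has_derivative (\<lambda>u. second_derivative F ?p u (?\<Gamma> ?p)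
      + DF ?p (frechet_derivative ?\<Gamma> (at ?p) u))) (at ?p)"
    by (rule has_derivative_directional[OF open_range smooth_F p has_derivative_vector_field[OF c Z p]])
  have D\<Xi>: "(\<Xi> has_derivative frechet_derivative \<Xi> (at ?p)) (at ?p)"
    using smooth_on_has_derivative[OF smooth_\<Xi> p] .
  have gauss: "?G q = DF q (?\<Gamma> q) + H v w (chart_inv c q) *\<^sub>R \<Xi> q" if "q \<in> snd c ` fst c" for q
    using that gauss_formula_coordinate by (auto simp: chart_inv[OF c] \<Gamma>_def)
  have Heq: "?H q = H v w (chart_inv c q)" if "q \<in> snd c ` fst c" for q
    using that \<xi>_nonzero gauss[OF that] by (auto simp: chart_inv[OF c])
  have "?H differentiable (at ?p)"
  proof (intro differentiable_divide differentiable_inner differentiable_diff)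
    show "?G differentiable (at ?p)" using G by (rule differentiableI)
    show "(\<lambda>q. DF q (?\<Gamma> q)) differentiable (at ?p)" using D\<Gamma> by (rule differentiableI)
    show "\<Xi> differentiable (at ?p)" "\<Xi> differentiable (at ?p)" "\<Xi> differentiable (at ?p)"
      using D\<Xi> by (rule differentiableI)+
    show "\<Xi> ?p \<bullet> \<Xi> ?p \<noteq> 0" using \<xi>_nonzero[OF x] by (simp add: chart_inv[OF c x])
  qed
  then obtain H' where H': "(?H has_derivative H') (at ?p)" by (auto simp: differentiable_def)
  have collect: "(a + k *\<^sub>R z) + (r *\<^sub>R (- b + t *\<^sub>R z) + s *\<^sub>R z) = (a - r *\<^sub>R b) + (k + r * t + s) *\<^sub>R z"
    for a b z :: 'b and k r s t by (simp add: algebra_simps)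
  have "((\<lambda>q. DF q (?\<Gamma> q) + ?H q *\<^sub>R \<Xi> q) has_derivative
      (\<lambda>u. (second_derivative F ?p u (?\<Gamma> ?p) + DF ?p (frechet_derivative ?\<Gamma> (at ?p) u))
         + (?H ?p *\<^sub>R frechet_derivative \<Xi> (at ?p) u + H' u *\<^sub>R \<Xi> ?p))) (at ?p)"
    by (intro has_derivative_add D\<Gamma> has_derivative_scaleR H' D\<Xi>)
  then have "(?G has_derivative
      (\<lambda>u. (second_derivative F ?p u (?\<Gamma> ?p) + DF ?p (frechet_derivative ?\<Gamma> (at ?p) u))
         + (?H ?p *\<^sub>R frechet_derivative \<Xi> (at ?p) u + H' u *\<^sub>R \<Xi> ?p))) (at ?p)"
    by (rule has_derivative_transform_within_open[OF _ open_range p], subst Heq)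
      (simp_all only: gauss)
  note G' = fun_cong[OF has_derivative_unique[OF G this], of u]
  have \<Xi>p: "\<Xi> ?p = \<xi> x" by (simp add: chart_inv[OF c x])
  from G'
  have "second_derivative (\<lambda>q. DF q w) ?p u v
      = (second_derivative F ?p u (?Z x c) + DF ?p (frechet_derivative ?\<Gamma> (at ?p) u))
         + (H v w x *\<^sub>R frechet_derivative \<Xi> (at ?p) u + H' u *\<^sub>R \<xi> x)"
    using Heq[OF p] \<Xi>p by (simp only: chart_inv[OF c x])
  also have "second_derivative F ?p u (?Z x c) + DF ?p (frechet_derivative ?\<Gamma> (at ?p) u)
      = DF ?p (nab (E u) ?Z x c) + h x (E u x) (?Z x) *\<^sub>R \<xi> x"
    using gauss_formula[OF E_field[of u] Z x] by (simp only: coordinate_field_at[OF c x])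
  also have "frechet_derivative \<Xi> (at ?p) u = - DF ?p (shape u x) + \<tau> x (E u x) *\<^sub>R \<xi> x"
    by (rule weingarten_formula[OF x])
  finally have "second_derivative (\<lambda>q. DF q w) ?p u v
      = DF ?p (nab (E u) ?Z x c - H v w x *\<^sub>R shape u x)
        + (h x (E u x) (?Z x) + H v w x * \<tau> x (E u x) + H' u) *\<^sub>R \<xi> x"
    by (simp only: collect linear_diff[OF linear_DF[OF x]] linear_cmul[OF linear_DF[OF x]])
  then show ?thesis by (rule that)
qed

text \<open>
  Exchanging \<open>u\<close> and \<open>v\<close> does not change the third derivative, so the difference of the two
  expressions for it has tangential part zero. The bracket term of the curvature vanishes, since
  coordinate fields commute.
\<close>
theorem gauss_equation:
  assumes R: "curvature_of M A nab R" and x: "x \<in> fst c"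
  shows "R x (E u x) (E v x) (E w x) = E (H v w x *\<^sub>R shape u x - H u w x *\<^sub>R shape v x) x"
proof -
  let ?p = "snd c x"
  let ?N = "\<lambda>u v. nab (E u) (nab (E v) (E w)) x c"
  have p: "?p \<in> snd c ` fst c" using x by blast
  obtain s where s: "second_derivative (\<lambda>q. DF q w) ?p u v
      = DF ?p (?N u v - H v w x *\<^sub>R shape u x) + s *\<^sub>R \<xi> x" using third_derivative[OF x] .
  obtain t where t: "second_derivative (\<lambda>q. DF q w) ?p v u
      = DF ?p (?N v u - H u w x *\<^sub>R shape v x) + t *\<^sub>R \<xi> x" using third_derivative[OF x] .
  have "second_derivative (\<lambda>q. DF q w) ?p u v = second_derivative (\<lambda>q. DF q w) ?p v u"
    by (rule second_derivative_symmetric[OF open_range smooth_on_frechet_derivative[OF smooth_F] p])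
  then have "DF ?p ((?N u v - H v w x *\<^sub>R shape u x) - (?N v u - H u w x *\<^sub>R shape v x)) = (t - s) *\<^sub>R \<xi> x"
    unfolding s t by (subst linear_diff[OF linear_DF[OF x]]) (simp add: algebra_simps)
  from DF_eq_transversal(1)[OF x this]
  have N: "?N u v - ?N v u = H v w x *\<^sub>R shape u x - H u w x *\<^sub>R shape v x"
    by (simp add: algebra_simps)
  let ?L = "lie_bracket A (E u) (E v)"
  have L0: "?L y = 0" if "y \<in> fst c" for y using lie_bracket_coordinate_fields[OF c that] .
  have L: "?L \<in> vector_fields A (fst c)" by (rule vector_fields_eq_0[OF c L0])
  have "DF ?p (nab ?L (E w) x c) = (- h x (?L x) (E w x)) *\<^sub>R \<xi> x"
    using gauss_formula[OF L E_field[of w] x] 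
      linear_0[OF linear_second_derivative_1[OF smooth_F p]]
    by (simp add: L0[OF x] E_constant[OF x] linear_0[OF linear_DF[OF x]] add_eq_0_iff)
  from DF_eq_transversal(1)[OF x this] have NL: "nab ?L (E w) x c = 0" .
  have field: "nab X (E w) x = E (nab X (E w) x c) x" "nab X (nab Y (E w)) x = E (nab X (nab Y (E w)) x c) x"
    if "X \<in> vector_fields A (fst c)" "Y \<in> vector_fields A (fst c)" for X Y
    using that by (auto intro!: tangent_vector_eq[OF c x] vector_field_tangent[OF _ x] induced_chart(1) E_field)
  have "R x (E u x) (E v x) (E w x) = nab (E u) (nab (E v) (E w)) x - nab (E v) (nab (E u) (E w)) x
      - nab ?L (E w) x"
    using R openin_chart[OF c] E_field x unfolding curvature_of_def by blast
  also have "\<dots> = E (?N u v) x - E (?N v u) x - E (nab ?L (E w) x c) x"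
    using field(1)[OF L L] field(2)[OF E_field[of u] E_field[of v]] field(2)[OF E_field[of v] E_field[of u]]
    by metis
  also have "\<dots> = E (?N u v - ?N v u) x" by (simp add: NL coordinate_field_diff)
  finally show ?thesis unfolding N .
qed

end

end

section \<open>Powers of the curvature on lists of tangent vectors\<close>

definition flatten :: "('v \<times> 'v) list \<Rightarrow> 'v list" where
  "flatten ps = concat (map (\<lambda>(a, b). [a, b]) ps)"

lemma flatten_simps [simp]:
  "flatten [] = []" "flatten (p # ps) = fst p # snd p # flatten ps"
  by (simp_all add: flatten_def split_beta)

lemma length_flatten [simp]: "length (flatten ps) = 2 * length ps"
  by (induction ps) auto

lemma sum_slots_flatten:
  fixes g :: "'v list \<Rightarrow> real"
  shows "(\<Sum>i<Suc (Suc (2 * length ps)). g ((flatten ps @ [z, w])[i := A ((flatten ps @ [z, w]) ! i)]))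
    = (\<Sum>j<length ps. g (flatten (ps[j := (A (fst (ps ! j)), snd (ps ! j))]) @ [z, w])
        + g (flatten (ps[j := (fst (ps ! j), A (snd (ps ! j)))]) @ [z, w]))
      + g (flatten ps @ [A z, w]) + g (flatten ps @ [z, A w])"
proof (induction ps arbitrary: g)
  case Nil
  then show ?case by simp
next
  case (Cons p ps)
  have two: "(\<Sum>i<Suc (Suc m). F i) = F 0 + F (Suc 0) + (\<Sum>i<m. F (Suc (Suc i)))" for F :: "nat \<Rightarrow> real" and m
    by (simp only: sum.lessThan_Suc_shift add.assoc)
  have *: "2 * length (p # ps) = Suc (Suc (2 * length ps))" by simp
  show ?case
    using Cons[of "\<lambda>l. g (fst p # snd p # l)"]
    by (subst *, subst two, simp only: length_Cons sum.lessThan_Suc_shift[of _ "length ps"])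
      (simp del: sum.lessThan_Suc)
qed

text \<open>
  Links the tensor fields on tangent vectors with the algebraic model; \<open>E\<close> parametrizes the tangent
  space at \<open>x\<close>.
\<close>
lemma (in real_curvature_algebra) curvature_action_power:
  assumes R: "\<And>a b v. R x (E a) (E b) (E v) = E (curv a b v)"
    and \<omega>: "\<And>z w. \<sigma> x (E z) (E w) = \<omega> z w"
  shows "(curvature_action R ^^ length ps) (form_tensor \<sigma>) x (map E (flatten ps @ [z, w])) = Rpow ps z w"
proof (induction ps arbitrary: z w rule: measure_induct_rule[of length])
  case (less ps)
  show ?case
  proof (cases ps)
    case Nil
    then show ?thesis by (simp add: form_tensor_def \<omega>)
  next
    case (Cons p qs)
    let ?T = "\<lambda>l. (curvature_action R ^^ length qs) (form_tensor \<sigma>) x (map E l)"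
    let ?A = "curv (fst p) (snd p)" and ?l = "flatten qs @ [z, w]"
    have IH: "?T (flatten rs @ [z, w]) = Rpow rs z w" if "length rs = length qs" for rs z w
      using less[of rs z w] that Cons by simp
    have "(curvature_action R ^^ length ps) (form_tensor \<sigma>) x (map E (flatten ps @ [z, w]))
        = - (\<Sum>i<Suc (Suc (2 * length qs)). (curvature_action R ^^ length qs) (form_tensor \<sigma>) x
            ((map E ?l)[i := R x (E (fst p)) (E (snd p)) ((map E ?l) ! i)]))"
      by (simp add: Cons curvature_action_def)
    also have "(\<Sum>i<Suc (Suc (2 * length qs)). (curvature_action R ^^ length qs) (form_tensor \<sigma>) x
            ((map E ?l)[i := R x (E (fst p)) (E (snd p)) ((map E ?l) ! i)]))
        = (\<Sum>i<Suc (Suc (2 * length qs)). ?T (?l[i := ?A (?l ! i)]))"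
    proof (rule sum.cong[OF refl])
      fix i assume "i \<in> {..<Suc (Suc (2 * length qs))}"
      then have i: "i < length ?l" by simp
      show "(curvature_action R ^^ length qs) (form_tensor \<sigma>) x
            ((map E ?l)[i := R x (E (fst p)) (E (snd p)) ((map E ?l) ! i)]) = ?T (?l[i := ?A (?l ! i)])"
        unfolding nth_map[OF i] R map_update ..
    qed
    also have "\<dots> = (\<Sum>j<length qs. Rpow (qs[j := (?A (fst (qs ! j)), snd (qs ! j))]) z w
        + Rpow (qs[j := (fst (qs ! j), ?A (snd (qs ! j)))]) z w) + Rpow qs (?A z) w + Rpow qs z (?A w)"
      unfolding sum_slots_flatten[where g = ?T] by (simp only: IH length_list_update)
    finally show ?thesis by (simp add: Cons)
  qed
qed

section \<open>Blocks of a simultaneous Jordan decomposition\<close>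

lemma sip_mult_index:
  assumes "B \<in> carrier_mat k k" "i < k" "j < k"
  shows "(sip_mat k * B) $$ (i, j) = B $$ (k - 1 - i, j)"
proof -
  have "(sip_mat k * B) $$ (i, j) = (\<Sum>l = 0..<k. (if i + l + 1 = k then 1 else 0) * B $$ (l, j))"
    using assms by (auto simp: sip_mat_def times_mat_def scalar_prod_def intro!: sum.cong)
  also have "\<dots> = (\<Sum>l = 0..<k. if l = k - 1 - i then B $$ (l, j) else 0)"
    using assms by (intro sum.cong) auto
  finally show ?thesis using assms by (simp add: sum.delta)
qed

lemma symmetric_matI:
  assumes "B \<in> carrier_mat k k" "\<And>i j. i < k \<Longrightarrow> j < k \<Longrightarrow> B $$ (i, j) = B $$ (j, i)"
  shows "transpose_mat B = B"
  using assms by (intro eq_matI) auto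

lemma real_jordan_block_carrier: "real_jordan_block k a \<in> carrier_mat k k"
  by (simp add: real_jordan_block_def)

lemma complex_jordan_block_carrier: "complex_jordan_block k \<alpha> \<beta> \<in> carrier_mat (2 * k) (2 * k)"
  by (simp add: complex_jordan_block_def)

lemma sip_carrier: "sip_mat k \<in> carrier_mat k k"
  by (simp add: sip_mat_def)

lemma sip_real_jordan_symmetric:
  "transpose_mat (sip_mat k * real_jordan_block k a) = sip_mat k * real_jordan_block k a"
proof (rule symmetric_matI[of _ k])
  fix i j assume ij: "i < k" "j < k"
  show "(sip_mat k * real_jordan_block k a) $$ (i, j) = (sip_mat k * real_jordan_block k a) $$ (j, i)"
    unfolding sip_mult_index[OF real_jordan_block_carrier ij]
      sip_mult_index[OF real_jordan_block_carrier ij(2,1)]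
    using ij by (auto simp: real_jordan_block_def)
qed (intro mult_carrier_mat[OF sip_carrier real_jordan_block_carrier])

text \<open>
  Multiplication by a sip matrix reverses the rows, after which the position \<open>(i, j)\<close> carries an entry
  that depends on \<open>i + j\<close> and \<open>i div 2 + j div 2\<close> only.
\<close>
lemma sip_complex_jordan_symmetric:
  "transpose_mat (sip_mat (2 * k) * complex_jordan_block k \<alpha> \<beta>) = sip_mat (2 * k) * complex_jordan_block k \<alpha> \<beta>"
proof (rule symmetric_matI[of _ "2 * k"])
  fix i j assume ij: "i < 2 * k" "j < 2 * k"
  have val: "complex_jordan_block k \<alpha> \<beta> $$ (2 * k - 1 - i, j)
      = (if i div 2 + j div 2 + 1 = k
         then if i + j + 1 = 2 * k then \<alpha> else if 2 * k \<le> i + j then \<beta> else - \<beta>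
         else if i + j + 3 = 2 * k then 1 else 0)" if ij: "i < 2 * k" "j < 2 * k" for i j
  proof -
    have "(2 * k - 1 - i) div 2 = j div 2 \<longleftrightarrow> i div 2 + j div 2 + 1 = k" using ij by linarith
    moreover have "2 * k - 1 - i = j \<longleftrightarrow> i + j + 1 = 2 * k" using ij by linarith
    moreover have "2 * k - 1 - i < j \<longleftrightarrow> 2 * k \<le> i + j" using ij by linarith
    moreover have "2 * k - 1 - i = j + 2 \<longleftrightarrow> i + j + 3 = 2 * k" using ij by linarith
    moreover have "complex_jordan_block k \<alpha> \<beta> $$ (2 * k - 1 - i, j)
      = (if (2 * k - 1 - i) div 2 = j div 2
         then if 2 * k - 1 - i = j then \<alpha> else if 2 * k - 1 - i < j then \<beta> else - \<beta>
         else if 2 * k - 1 - i = j + 2 then 1 else 0)"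
      using ij unfolding complex_jordan_block_def by (subst index_mat(1)) auto
    ultimately show ?thesis by (simp only:)
  qed
  show "(sip_mat (2 * k) * complex_jordan_block k \<alpha> \<beta>) $$ (i, j)
      = (sip_mat (2 * k) * complex_jordan_block k \<alpha> \<beta>) $$ (j, i)"
    unfolding sip_mult_index[OF complex_jordan_block_carrier ij]
      sip_mult_index[OF complex_jordan_block_carrier ij(2,1)] val[OF ij] val[OF ij(2,1)]
    by (simp only: add.commute[of i j] add.commute[of "i div 2" "j div 2"])
qed (intro mult_carrier_mat[OF sip_carrier complex_jordan_block_carrier])

lemma transpose_uminus_mat: "transpose_mat (- B) = - transpose_mat (B :: real mat)"
  by (rule eq_matI) auto

lemma diag_block_mat_carrier:
  assumes "\<And>B. B \<in> set Bs \<Longrightarrow> square_mat B"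
  shows "diag_block_mat Bs \<in> carrier_mat (sum_list (map dim_row Bs)) (sum_list (map dim_row Bs))"
  using diag_block_mat_square[of Bs] assms by (auto simp: dim_diag_block_mat)

text \<open>
  For symmetric \<open>H\<close> this says that the operator with matrix \<open>B\<close> is self-adjoint for the form with
  matrix \<open>H\<close>.
\<close>
definition symmetrizes :: "real mat \<Rightarrow> real mat \<Rightarrow> bool" where
  "symmetrizes H B \<longleftrightarrow> square_mat B \<and> H \<in> carrier_mat (dim_row B) (dim_row B) \<and>
     transpose_mat (H * B) = H * B"

lemma symmetrizes_diag_block_mat:
  assumes "list_all2 symmetrizes Hs Bs"
  shows "symmetrizes (diag_block_mat Hs) (diag_block_mat Bs)"
  using assms
proof (induction rule: list_all2_induct)
  case Nil
  show ?case by (auto simp: symmetrizes_def intro!: eq_matI)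
next
  case (Cons H Hs B Bs)
  let ?H = "diag_block_mat Hs" and ?B = "diag_block_mat Bs"
  define k where "k = dim_row B"
  define m where "m = dim_row ?B"
  have c: "H \<in> carrier_mat k k" "B \<in> carrier_mat k k" "?H \<in> carrier_mat m m" "?B \<in> carrier_mat m m"
    using Cons unfolding symmetrizes_def k_def m_def by auto
  note z = zero_carrier_mat[of k m] zero_carrier_mat[of m k]
  have eq: "diag_block_mat (H # Hs) = four_block_mat H (0\<^sub>m k m) (0\<^sub>m m k) ?H"
    "diag_block_mat (B # Bs) = four_block_mat B (0\<^sub>m k m) (0\<^sub>m m k) ?B"
    using c by (auto simp: Let_def)
  have HB: "H * B \<in> carrier_mat k k" "?H * ?B \<in> carrier_mat m m"
    using c by auto
  have prod: "diag_block_mat (H # Hs) * diag_block_mat (B # Bs)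
      = four_block_mat (H * B) (0\<^sub>m k m) (0\<^sub>m m k) (?H * ?B)"
    unfolding eq mult_four_block_mat[OF c(1) z(1) z(2) c(3) c(2) z(1) z(2) c(4)]
    using c HB by simp
  have "transpose_mat (diag_block_mat (H # Hs) * diag_block_mat (B # Bs))
      = diag_block_mat (H # Hs) * diag_block_mat (B # Bs)"
    unfolding prod transpose_four_block_mat[OF HB(1) z(1) z(2) HB(2)]
    using Cons by (simp add: symmetrizes_def)
  moreover have "square_mat (diag_block_mat (B # Bs))"
    "diag_block_mat (H # Hs) \<in> carrier_mat (dim_row (diag_block_mat (B # Bs))) (dim_row (diag_block_mat (B # Bs)))"
    unfolding eq using c by auto
  ultimately show ?case unfolding symmetrizes_def by blast
qed

lemma diag_block_mat_column:
  assumes "\<And>B. B \<in> set Bs \<Longrightarrow> square_mat B" "l < length Bs" "j < dim_row (Bs ! l)"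
    and "i < sum_list (map dim_row Bs)"
  defines "o' \<equiv> sum_list (map dim_row (take l Bs))"
  shows "diag_block_mat Bs $$ (i, o' + j)
    = (if o' \<le> i \<and> i < o' + dim_row (Bs ! l) then Bs ! l $$ (i - o', j) else 0)"
  using assms(1-4) unfolding o'_def
proof (induction Bs arbitrary: l i)
  case (Cons B Bs)
  let ?D = "diag_block_mat Bs"
  have D: "?D \<in> carrier_mat (sum_list (map dim_row Bs)) (sum_list (map dim_row Bs))"
    using Cons.prems(1) by (intro diag_block_mat_carrier) simp
  have B: "dim_col B = dim_row B" using Cons.prems(1) by simp
  show ?case
  proof (cases l)
    case 0
    then show ?thesis using Cons.prems D B by (auto simp: Let_def)
  next
    case (Suc m)
    let ?o = "sum_list (map dim_row (take m Bs))"
    have bound: "?o + j < sum_list (map dim_row Bs)"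
    proof -
      have "sum_list (map dim_row Bs) = ?o + sum_list (map dim_row (drop m Bs))"
        by (metis append_take_drop_id map_append sum_list_append)
      also have "drop m Bs = Bs ! m # drop (Suc m) Bs" using Cons.prems Suc by (simp add: Cons_nth_drop_Suc)
      finally show ?thesis using Cons.prems Suc by simp
    qed
    show ?thesis
    proof (cases "i < dim_row B")
      case True
      then show ?thesis using Cons.prems D B Suc bound by (auto simp: Let_def)
    next
      case False
      have "diag_block_mat (B # Bs) $$ (i, dim_row B + (?o + j)) = ?D $$ (i - dim_row B, ?o + j)"
        using False Cons.prems(4) D B bound by (auto simp: Let_def)
      also have "\<dots> = (if ?o \<le> i - dim_row B \<and> i - dim_row B < ?o + dim_row (Bs ! m)
          then Bs ! m $$ (i - dim_row B - ?o, j) else 0)"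
        by (rule Cons.IH) (use Cons.prems Suc False in auto)
      finally show ?thesis using False Suc by (auto simp: add.assoc)
    qed
  qed
qed simp

lemma sum_list_take_bound:
  "l < length Bs \<Longrightarrow> j < dim_row (Bs ! l) \<Longrightarrow>
    sum_list (map dim_row (take l Bs)) + j < sum_list (map dim_row Bs)"
proof -
  assume l: "l < length Bs" "j < dim_row (Bs ! l)"
  have "sum_list (map dim_row Bs) = sum_list (map dim_row (take l Bs)) + sum_list (map dim_row (drop l Bs))"
    by (metis append_take_drop_id map_append sum_list_append)
  also have "drop l Bs = Bs ! l # drop (Suc l) Bs" using l by (simp add: Cons_nth_drop_Suc)
  finally show ?thesis using l by simp
qed

text \<open>
  The self-adjointness of the shape operator is read off from the blocks: the product of the matrices
  is symmetric because each of its blocks is. The plane is spanned by the last two basis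
  vectors of the first complex block; in the sip matrix of size \<open>2k\<close> they are paired with the first
  two basis vectors of the block, and with each other only for \<open>k = 1\<close>.
\<close>
theorem jordan_decomposition_blocks:
  assumes "simultaneous_jordan_decomposition V d S h e q r Ss Hs"
  shows "symmetrizes (diag_block_mat Hs) (diag_block_mat Ss)"
    and "r > 0 \<Longrightarrow> \<exists>i (k::nat) \<alpha> \<beta>. i + 1 < d \<and> k \<ge> 1 \<and> \<beta> \<noteq> 0 \<and>
       S (e i) = \<alpha> *\<^sub>R e i - \<beta> *\<^sub>R e (i + 1) \<and> S (e (i + 1)) = \<beta> *\<^sub>R e i + \<alpha> *\<^sub>R e (i + 1) \<and>
       h (e i) (e i) = 0 \<and> h (e (i + 1)) (e (i + 1)) = 0 \<and> h (e i) (e (i + 1)) = (if k = 1 then 1 else 0)"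
proof -
  note D = assms[unfolded simultaneous_jordan_decomposition_def]
  have len: "length Ss = q + r" "length Hs = q + r" using D by blast+
  have block: "symmetrizes (Hs ! i) (Ss ! i)" if "i < q + r" for i
  proof (cases "i < q")
    case True
    then obtain k a where "Ss ! i = real_jordan_block k a" "Hs ! i = sip_mat k \<or> Hs ! i = - sip_mat k"
      using D by blast
    moreover have "- sip_mat k * real_jordan_block k a = - (sip_mat k * real_jordan_block k a)"
      using sip_carrier[of k] real_jordan_block_carrier[of k a] by simp
    ultimately show ?thesis
      using sip_carrier[of k] real_jordan_block_carrier[of k a]
      by (auto simp: symmetrizes_def sip_real_jordan_symmetric transpose_uminus_mat)
  next
    case False
    then have "q \<le> i \<and> i < q + r" using that by simp
    then obtain k \<alpha> \<beta> where "Ss ! i = complex_jordan_block k \<alpha> \<beta>" "Hs ! i = sip_mat (2 * k)"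
      using D by blast
    then show ?thesis
      using sip_carrier[of "2 * k"] complex_jordan_block_carrier[of k \<alpha> \<beta>]
      by (auto simp: symmetrizes_def sip_complex_jordan_symmetric)
  qed
  then have all: "list_all2 symmetrizes Hs Ss" using len by (simp add: list_all2_conv_all_nth)
  then show "symmetrizes (diag_block_mat Hs) (diag_block_mat Ss)" by (rule symmetrizes_diag_block_mat)
  assume r: "r > 0"
  then obtain k \<alpha> \<beta> where k: "k \<ge> 1" and \<beta>: "\<beta> \<noteq> 0"
    and Sq: "Ss ! q = complex_jordan_block k \<alpha> \<beta>" and Hq: "Hs ! q = sip_mat (2 * k)"
    using D by (metis le_refl less_add_same_cancel1)
  have sqS: "square_mat B" if "B \<in> set Ss" for B
    using that block len by (auto simp: in_set_conv_nth symmetrizes_def)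
  have sqH: "square_mat B" if B: "B \<in> set Hs" for B
  proof -
    obtain i where "i < q + r" "B = Hs ! i" using B unfolding in_set_conv_nth len by blast
    then have c: "B \<in> carrier_mat (dim_row (Ss ! i)) (dim_row (Ss ! i))"
      using block unfolding symmetrizes_def by blast
    show ?thesis unfolding square_mat.simps carrier_matD[OF c] ..
  qed
  have dims: "map dim_row Hs = map dim_row Ss"
    using all by (auto simp: list_all2_conv_all_nth symmetrizes_def intro!: nth_equalityI)
  define o' where "o' = sum_list (map dim_row (take q Ss))"
  have o'H: "o' = sum_list (map dim_row (take q Hs))" unfolding o'_def take_map[symmetric] dims ..
  have d: "d = sum_list (map dim_row Ss)" "d = sum_list (map dim_row Hs)"
    using D by (auto simp: dims dim_diag_block_mat)
  have dimq: "dim_row (Ss ! q) = 2 * k" "dim_row (Hs ! q) = 2 * k"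
    using Sq Hq by (simp_all add: complex_jordan_block_def sip_mat_def)
  have bound: "o' + j < d" if "j < 2 * k" for j
    using sum_list_take_bound[of q Ss j] that dimq len r by (simp add: o'_def d(1))
  have colS: "diag_block_mat Ss $$ (i, o' + j)
      = (if o' \<le> i \<and> i < o' + 2 * k then complex_jordan_block k \<alpha> \<beta> $$ (i - o', j) else 0)"
    if "i < d" "j < 2 * k" for i j
    using diag_block_mat_column[where Bs = Ss and l = q and j = j and i = i, OF sqS] that len r dimq Sq unfolding o'_def d(1) by simp
  have colH: "diag_block_mat Hs $$ (i, o' + j)
      = (if o' \<le> i \<and> i < o' + 2 * k then sip_mat (2 * k) $$ (i - o', j) else 0)"
    if "i < d" "j < 2 * k" for i j
    using diag_block_mat_column[where Bs = Hs and l = q and j = j and i = i, OF sqH] that len r dimq Hq unfolding o'H d(2) by simp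
  define i where "i = o' + (2 * k - 2)"
  have i1: "i + 1 = o' + (2 * k - 1)" using k by (simp add: i_def)
  have ij: "i < d" "i + 1 < d" using bound[of "2 * k - 2"] bound[of "2 * k - 1"] k i1 by (simp_all add: i_def)
  have two: "(\<Sum>l<d. c l *\<^sub>R e l) = c i *\<^sub>R e i + c (i + 1) *\<^sub>R e (i + 1)"
    if "\<And>l. l < d \<Longrightarrow> l \<noteq> i \<Longrightarrow> l \<noteq> i + 1 \<Longrightarrow> c l = 0" for c
  proof -
    have "(\<Sum>l<d. c l *\<^sub>R e l) = (\<Sum>l\<in>{i, i + 1}. c l *\<^sub>R e l)"
      using ij that by (intro sum.mono_neutral_right) auto
    then show ?thesis by simp
  qed
  have m: "(2 * k - 2) div 2 = k - 1" "(2 * k - 1) div 2 = k - 1" using k by linarith+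
  have S: "S (e j) = (\<Sum>i<d. (diag_block_mat Ss $$ (i, j)) *\<^sub>R e i)" if "j < d" for j using D that by blast
  have h: "h (e i) (e j) = diag_block_mat Hs $$ (i, j)" if "i < d" "j < d" for i j using D that by blast
  have J: "complex_jordan_block k \<alpha> \<beta> $$ (l, 2 * k - 2) = (if l = 2 * k - 2 then \<alpha> else if l = 2 * k - 1 then - \<beta> else 0)"
    "complex_jordan_block k \<alpha> \<beta> $$ (l, 2 * k - 1) = (if l = 2 * k - 2 then \<beta> else if l = 2 * k - 1 then \<alpha> else 0)"
    if "l < 2 * k" for l
  proof -
    obtain m where km: "k = Suc m" using k by (cases k) auto
    have "l < 2 * m + 2" "l div 2 = m \<longleftrightarrow> l = 2 * m \<or> l = 2 * m + 1" using that km by linarith+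
    then show "complex_jordan_block k \<alpha> \<beta> $$ (l, 2 * k - 2) = (if l = 2 * k - 2 then \<alpha> else if l = 2 * k - 1 then - \<beta> else 0)"
      "complex_jordan_block k \<alpha> \<beta> $$ (l, 2 * k - 1) = (if l = 2 * k - 2 then \<beta> else if l = 2 * k - 1 then \<alpha> else 0)"
      unfolding km by (auto simp: complex_jordan_block_def)
  qed
  have Si: "diag_block_mat Ss $$ (l, i) = (if l = i then \<alpha> else if l = i + 1 then - \<beta> else 0)"
    "diag_block_mat Ss $$ (l, i + 1) = (if l = i then \<beta> else if l = i + 1 then \<alpha> else 0)" if "l < d" for l
  proof -
    have col: "diag_block_mat Ss $$ (l, i)
        = (if o' \<le> l \<and> l < o' + 2 * k then complex_jordan_block k \<alpha> \<beta> $$ (l - o', 2 * k - 2) else 0)"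
      "diag_block_mat Ss $$ (l, i + 1)
        = (if o' \<le> l \<and> l < o' + 2 * k then complex_jordan_block k \<alpha> \<beta> $$ (l - o', 2 * k - 1) else 0)"
      unfolding i1 unfolding i_def by (intro colS that; use k in simp)+
    have "diag_block_mat Ss $$ (l, i) = (if l = i then \<alpha> else if l = i + 1 then - \<beta> else 0) \<and>
      diag_block_mat Ss $$ (l, i + 1) = (if l = i then \<beta> else if l = i + 1 then \<alpha> else 0)"
    proof (cases "o' \<le> l \<and> l < o' + 2 * k")
      case True
      then have "l - o' < 2 * k" "l - o' = 2 * k - 2 \<longleftrightarrow> l = i" "l - o' = 2 * k - 1 \<longleftrightarrow> l = i + 1"
        using k unfolding i1 unfolding i_def by linarith+
      then show ?thesis using True by (simp only: col J if_True simp_thms)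
    next
      case False
      then have "l \<noteq> i" "l \<noteq> i + 1" using k unfolding i1 unfolding i_def by linarith+
      then show ?thesis using False by (simp only: col if_False simp_thms)
    qed
    then show "diag_block_mat Ss $$ (l, i) = (if l = i then \<alpha> else if l = i + 1 then - \<beta> else 0)"
      "diag_block_mat Ss $$ (l, i + 1) = (if l = i then \<beta> else if l = i + 1 then \<alpha> else 0)" by blast+
  qed
  have Hi: "diag_block_mat Hs $$ (i, i) = 0" "diag_block_mat Hs $$ (i + 1, i + 1) = 0"
    "diag_block_mat Hs $$ (i, i + 1) = (if k = 1 then 1 else 0)"
  proof -
    have col: "diag_block_mat Hs $$ (o' + j, o' + j') = (if j + j' + 1 = 2 * k then 1 else 0)"
      if "j < 2 * k" "j' < 2 * k" for j j'
      using colH[OF bound[OF that(1)] that(2)] that by (simp add: sip_mat_def)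
    have lt: "2 * k - 2 < 2 * k" "2 * k - 1 < 2 * k" using k by linarith+
    have "(2 * k - 2) + (2 * k - 2) + 1 \<noteq> 2 * k" "(2 * k - 1) + (2 * k - 1) + 1 \<noteq> 2 * k"
      "(2 * k - 2) + (2 * k - 1) + 1 = 2 * k \<longleftrightarrow> k = 1" using k by presburger+
    then show "diag_block_mat Hs $$ (i, i) = 0" "diag_block_mat Hs $$ (i + 1, i + 1) = 0"
      "diag_block_mat Hs $$ (i, i + 1) = (if k = 1 then 1 else 0)"
      unfolding i1 unfolding i_def col[OF lt(1,1)] col[OF lt(2,2)] col[OF lt(1,2)] by simp_all
  qed
  have "S (e i) = \<alpha> *\<^sub>R e i - \<beta> *\<^sub>R e (i + 1)"
    unfolding S[OF ij(1)] by (subst two) (use ij in \<open>simp_all add: Si\<close>)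
  moreover have "S (e (i + 1)) = \<beta> *\<^sub>R e i + \<alpha> *\<^sub>R e (i + 1)"
    unfolding S[OF ij(2)] by (subst two) (use ij in \<open>simp_all add: Si[simplified]\<close>)
  ultimately show "\<exists>i (k::nat) \<alpha> \<beta>. i + 1 < d \<and> k \<ge> 1 \<and> \<beta> \<noteq> 0 \<and>
       S (e i) = \<alpha> *\<^sub>R e i - \<beta> *\<^sub>R e (i + 1) \<and> S (e (i + 1)) = \<beta> *\<^sub>R e i + \<alpha> *\<^sub>R e (i + 1) \<and>
       h (e i) (e i) = 0 \<and> h (e (i + 1)) (e (i + 1)) = 0 \<and> h (e i) (e (i + 1)) = (if k = 1 then 1 else 0)"
    using ij(2) k \<beta> h[OF ij(1,1)] h[OF ij(2,2)] h[OF ij] unfolding Hi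
    by - (rule exI[of _ i], rule exI[of _ k], rule exI[of _ \<alpha>], rule exI[of _ \<beta>], intro conjI)
qed

section \<open>Affine hypersurfaces with an almost symplectic form\<close>

lemma linear_eval: "linear (\<lambda>v :: 'a \<Rightarrow> 'b::real_vector. v c)"
  by (rule linearI) (simp_all add: scaleR_fun_def)

text \<open>
  In a chart around \<open>x\<close> the tangent space becomes \<open>real^'m\<close> and, by the Gauss equation, a
  curvature algebra in the above sense. The invariant plane of a complex block then falls under one
  of the two cases, isotropic or hyperbolic; in the hyperbolic case a further basis vector gives the
  contradiction.
\<close>
theorem (in affine_hypersurface) no_complex_jordan_block:
  fixes \<omega> :: "'a \<Rightarrow> ('a, 'm) tvec \<Rightarrow> ('a, 'm) tvec \<Rightarrow> real"
  assumes R: "curvature_of M A nab R"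
    and nondeg: "nondegenerate_at A x (h x)"
    and \<omega>: "bilinear_at A x (\<omega> x)" "\<And>u. u \<in> tangent_space A x \<Longrightarrow> \<omega> x u u = 0"
      "nondegenerate_at A x (\<omega> x)"
    and p: "p \<ge> 1"
    and van: "\<And>vs. length vs = 2 * p + 2 \<Longrightarrow> set vs \<subseteq> tangent_space A x \<Longrightarrow>
      (curvature_action R ^^ p) (form_tensor \<omega>) x vs = 0"
    and x: "x \<in> topspace M"
    and d: "d \<ge> 3"
    and jordan: "simultaneous_jordan_decomposition (tangent_space A x) d (S x) (h x) e q r Ss Hs"
  shows "r = 0"
proof (rule ccontr)
  assume "r \<noteq> 0"
  obtain c where c: "c \<in> A" and xc: "x \<in> fst c"
    using smooth_atlas x unfolding smooth_atlas_def by blast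
  let ?E = "\<lambda>v. coordinate_field A c v x"
  let ?h = "\<lambda>v w. H c v w x" and ?\<omega> = "\<lambda>v w. \<omega> x (?E v) (?E w)" and ?S = "\<lambda>v. shape c v x"
  have E_tan: "?E v \<in> tangent_space A x" for v by (rule coordinate_field_tangent[OF c xc])
  have E_inv: "?E (v c) = v" if "v \<in> tangent_space A x" for v
    using tangent_vector_eq[OF c xc that] by simp
  have E_at: "?E v c = v" for v using coordinate_field_at[OF c xc] .
  have E_eq_0: "v = 0" if "?E v = 0" for v using E_at[of v] that by simp
  have h_def: "?h v w = h x (?E v) (?E w)" for v w by (simp add: H_def[OF c])
  have S_def: "?S v = S x (?E v) c" for v by (simp add: shape_def[OF c])
  have h_sym: "?h v w = ?h w v" for v w by (rule H_sym[OF c xc])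
  have h_lin: "linear (\<lambda>v. ?h v w)" for w by (rule linear_H[OF c xc])
  have S_lin: "linear ?S" by (rule linear_shape[OF c xc])
  have \<omega>_lin: "linear (\<lambda>v. ?\<omega> v w)" "linear (?\<omega> w)" for w
  proof -
    have "\<omega> x (?E u + ?E v) (?E w) = ?\<omega> u w + ?\<omega> v w" "\<omega> x (a *\<^sub>R ?E u) (?E w) = a * ?\<omega> u w"
      "\<omega> x (?E w) (?E u + ?E v) = ?\<omega> w u + ?\<omega> w v" "\<omega> x (?E w) (a *\<^sub>R ?E u) = a * ?\<omega> w u" for u v a
      using \<omega>(1) E_tan unfolding bilinear_at_def by blast+
    then show "linear (\<lambda>v. ?\<omega> v w)" "linear (?\<omega> w)"
      by (auto intro!: linearI simp: coordinate_field_add coordinate_field_scale)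
  qed

  have indep: "independent (e ` {..<d})" and inj: "inj_on e {..<d}"
    and span: "span (e ` {..<d}) = tangent_space A x"
    and Se: "\<And>j. j < d \<Longrightarrow> S x (e j) = (\<Sum>i<d. (diag_block_mat Ss $$ (i, j)) *\<^sub>R e i)"
    and he: "\<And>i j. i < d \<Longrightarrow> j < d \<Longrightarrow> h x (e i) (e j) = diag_block_mat Hs $$ (i, j)"
    and dims: "diag_block_mat Ss \<in> carrier_mat d d" "diag_block_mat Hs \<in> carrier_mat d d"
    using jordan unfolding simultaneous_jordan_decomposition_def by blast+
  have e_tan: "e i \<in> tangent_space A x" if "i < d" for i
    using that unfolding span[symmetric] by (intro span_base) blast
  define b where "b i = e i c" for i
  have Eb: "?E (b i) = e i" if "i < d" for i using E_inv[OF e_tan[OF that]] by (simp add: b_def)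
  have span_b: "span (b ` {..<d}) = UNIV"
  proof -
    have "span (b ` {..<d}) = (\<lambda>v. v c) ` span (e ` {..<d})"
      by (simp add: linear_span_image[OF linear_eval, symmetric] image_image b_def)
    also have "\<dots> = UNIV" unfolding span using E_at E_tan by (metis UNIV_eq_I image_eqI)
    finally show ?thesis .
  qed
  have hb: "?h (b i) (b j) = diag_block_mat Hs $$ (i, j)" if "i < d" "j < d" for i j
    using that by (simp add: h_def Eb he)
  have Sb: "?S (b j) = (\<Sum>i<d. (diag_block_mat Ss $$ (i, j)) *\<^sub>R b i)" if "j < d" for j
    unfolding S_def Eb[OF that] Se[OF that] unfolding b_def
    using linear_sum[OF linear_eval[of c], of "\<lambda>i. (diag_block_mat Ss $$ (i, j)) *\<^sub>R e i" "{..<d}"]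
    by (simp add: scaleR_fun_def)
  have symm: "transpose_mat (diag_block_mat Hs * diag_block_mat Ss) = diag_block_mat Hs * diag_block_mat Ss"
    using jordan_decomposition_blocks(1)[OF jordan] unfolding symmetrizes_def by blast
  have hS: "?h (?S (b j)) (b i) = (diag_block_mat Hs * diag_block_mat Ss) $$ (i, j)"
    if "i < d" "j < d" for i j
  proof -
    have "?h (?S (b j)) (b i) = (\<Sum>l<d. diag_block_mat Ss $$ (l, j) * ?h (b l) (b i))"
      unfolding Sb[OF that(2)] linear_sum[OF h_lin] linear_cmul[OF h_lin] by simp
    also have "\<dots> = (\<Sum>l<d. diag_block_mat Hs $$ (i, l) * diag_block_mat Ss $$ (l, j))"
    proof (rule sum.cong[OF refl])
      fix l assume "l \<in> {..<d}"
      then have "?h (b l) (b i) = diag_block_mat Hs $$ (i, l)"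
        using hb[OF that(1), of l] h_sym[of "b l" "b i"] by simp
      then show "diag_block_mat Ss $$ (l, j) * ?h (b l) (b i)
          = diag_block_mat Hs $$ (i, l) * diag_block_mat Ss $$ (l, j)" by simp
    qed
    also have "\<dots> = (diag_block_mat Hs * diag_block_mat Ss) $$ (i, j)"
      using that dims by (auto simp: scalar_prod_def atLeast0LessThan)
    finally show ?thesis .
  qed
  have selfadj_b: "?h (?S (b j)) (b i) = ?h (b j) (?S (b i))" if "i < d" "j < d" for i j
  proof -
    have "(diag_block_mat Hs * diag_block_mat Ss) $$ (i, j) = (diag_block_mat Hs * diag_block_mat Ss) $$ (j, i)"
      using that dims index_transpose_mat(1)[of i "diag_block_mat Hs * diag_block_mat Ss" j] symm by simp
    then show ?thesis using hS that h_sym[of "b j" "?S (b i)"] by simp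
  qed
  have h_lin': "linear (?h v)" for v using h_lin[of v] by (simp add: h_sym[of v])
  have lin_hS: "linear (\<lambda>v. ?h (?S v) w)" "linear (\<lambda>v. ?h v (?S w))" "linear (\<lambda>v. ?h (?S w) v)"
    "linear (\<lambda>v. ?h w (?S v))" for w
    using linear_compose[OF S_lin h_lin, of w] linear_compose[OF S_lin h_lin', of w] h_lin h_lin'
    by (simp_all add: o_def)
  have selfadj: "?h (?S v) w = ?h v (?S w)" for v w
  proof -
    have 1: "?h (?S v) (b i) = ?h v (?S (b i))" if "i < d" for i v
      by (rule linear_eq_on[OF lin_hS(1,2), of _ "b ` {..<d}"])
        (use span_b selfadj_b that in auto)
    show ?thesis
      by (rule linear_eq_on[OF lin_hS(3,4), of _ "b ` {..<d}"]) (use span_b 1 in auto)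
  qed

  interpret real_curvature_algebra ?h ?\<omega> ?S
  proof
    fix u v w :: "real^'m" and r :: real
    show "?h (u + v) w = ?h u w + ?h v w" by (rule linear_add[OF h_lin])
    show "?h (r *\<^sub>R u) w = r * ?h u w" using linear_cmul[OF h_lin, of r u w] by simp
    show "?\<omega> (u + v) w = ?\<omega> u w + ?\<omega> v w" by (rule linear_add[OF \<omega>_lin(1)])
    show "?\<omega> (r *\<^sub>R u) w = r * ?\<omega> u w" using linear_cmul[OF \<omega>_lin(1), of r u w] by simp
    show "?S (u + v) = ?S u + ?S v" by (rule linear_add[OF S_lin])
    show "?S (r *\<^sub>R u) = r *\<^sub>R ?S u" by (rule linear_cmul[OF S_lin])
    show "?h u v = ?h v u" by (rule h_sym)
    show "?h (?S u) v = ?h u (?S v)" by (rule selfadj)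
    have "?\<omega> (u + v) (u + v) = ?\<omega> u u + ?\<omega> u v + (?\<omega> v u + ?\<omega> v v)"
      unfolding linear_add[OF \<omega>_lin(1)] linear_add[OF \<omega>_lin(2)] by simp
    then show "?\<omega> u v = - ?\<omega> v u" by (simp add: \<omega>(2)[OF E_tan])
  next
    fix u assume "\<And>v. ?h u v = 0"
    then have "\<forall>v\<in>tangent_space A x. h x (?E u) v = 0" using E_inv h_def by metis
    then show "u = 0" using nondeg E_tan E_eq_0 unfolding nondegenerate_at_def by blast
  next
    fix u assume "\<And>v. ?\<omega> u v = 0"
    then have "\<forall>v\<in>tangent_space A x. \<omega> x (?E u) v = 0" using E_inv by metis
    then show "u = 0" using \<omega>(3) E_tan E_eq_0 unfolding nondegenerate_at_def by blast
  qed

  have Rpow0: "Rpow ps z w = 0" if "length ps = p" for ps z w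
  proof -
    have "R x (?E u) (?E v) (?E w) = ?E (curv u v w)" for u v w
      unfolding curv_def by (rule gauss_equation[OF c R xc])
    from curvature_action_power[where E = ?E and \<sigma> = \<omega> and R = R and x = x, OF this refl, of ps z w]
    show ?thesis using van[of "map ?E (flatten ps @ [z, w])"] that E_tan by auto
  qed

  obtain i k \<alpha> \<beta> where i: "i + 1 < d" and \<beta>: "\<beta> \<noteq> 0"
    and Se': "S x (e i) = \<alpha> *\<^sub>R e i - \<beta> *\<^sub>R e (i + 1)" "S x (e (i + 1)) = \<beta> *\<^sub>R e i + \<alpha> *\<^sub>R e (i + 1)"
    and he': "h x (e i) (e i) = 0" "h x (e (i + 1)) (e (i + 1)) = 0"
      "h x (e i) (e (i + 1)) = (if k = 1 then 1 else 0 :: real)" and "(k :: nat) \<ge> 1"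
    using jordan_decomposition_blocks(2)[OF jordan] \<open>r \<noteq> 0\<close> by blast
  then have i': "i < d" by simp
  let ?a = "b i" and ?b = "b (i + 1)"
  have Sa: "?S ?a = \<alpha> *\<^sub>R ?a - \<beta> *\<^sub>R ?b" and Sb': "?S ?b = \<beta> *\<^sub>R ?a + \<alpha> *\<^sub>R ?b"
    unfolding S_def Eb[OF i'] Eb[OF i] Se' unfolding b_def by (simp_all add: b_def scaleR_fun_def)
  have hab: "?h ?a ?a = 0" "?h ?b ?b = 0" "?h ?a ?b = (if k = 1 then 1 else 0)"
    unfolding h_def Eb[OF i'] Eb[OF i] he' by simp_all
  show False
  proof (cases "k = 1")
    case False
    have "e i \<noteq> 0" using indep i' dependent_zero by (metis image_eqI lessThan_iff)
    then have "?a \<noteq> 0" using Eb[OF i'] by (metis coordinate_field_0)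
    then show False using no_complex_eigenplane[OF Rpow0 p Sa Sb' \<beta>] hab False by simp
  next
    case True
    obtain j where j: "j < d" "j \<noteq> i" "j \<noteq> i + 1"
    proof -
      have "card {i, i + 1} < card {..<d}" using d by simp
      then have "\<not> {..<d} \<subseteq> {i, i + 1}" by (metis card_mono finite.emptyI finite.insertI not_le)
      then show ?thesis using that by auto
    qed
    have "\<alpha>\<^sup>2 + \<beta>\<^sup>2 > 0" using \<beta> by (simp add: add_nonneg_pos)
    then have \<mu>: "(sqrt (\<alpha>\<^sup>2 + \<beta>\<^sup>2))\<^sup>2 = \<alpha>\<^sup>2 + \<beta>\<^sup>2" "sqrt (\<alpha>\<^sup>2 + \<beta>\<^sup>2) \<noteq> 0"
      using \<beta> by simp_all
    obtain s t where "b j = s *\<^sub>R ?a + t *\<^sub>R ?b"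
      using no_complementary_vector[OF Rpow0 p Sa Sb' hab(1,2) _ \<mu> \<beta>, of "b j"] hab(3) True by auto
    then have "e j = s *\<^sub>R e i + t *\<^sub>R e (i + 1)"
      using Eb[OF j(1)] Eb[OF i'] Eb[OF i] by (simp add: coordinate_field_add coordinate_field_scale)
    moreover have "e i \<in> e ` {..<d} - {e j}" "e (i + 1) \<in> e ` {..<d} - {e j}"
      using inj j i i' by (auto dest: inj_onD)
    ultimately have "e j \<in> span (e ` {..<d} - {e j})"
      by (simp add: span_add span_base span_scale)
    then show False using indep j(1) unfolding dependent_def by blast
  qed
qed

theorem theorem4p17:
  fixes M :: "'a topology"
    and A :: "('a, 'm::finite) chart set"
    and n p q r :: nat
    and f \<xi> :: "'a \<Rightarrow> real^'k::finite"
    and nab :: "('a, 'm) vfield \<Rightarrow> ('a, 'm) vfield \<Rightarrow> ('a, 'm) vfield"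
    and h \<omega> :: "'a \<Rightarrow> ('a, 'm) tvec \<Rightarrow> ('a, 'm) tvec \<Rightarrow> real"
    and S :: "'a \<Rightarrow> ('a, 'm) tvec \<Rightarrow> ('a, 'm) tvec"
    and \<tau> :: "'a \<Rightarrow> ('a, 'm) tvec \<Rightarrow> real"
    and R :: "'a \<Rightarrow> ('a, 'm) tvec \<Rightarrow> ('a, 'm) tvec \<Rightarrow> ('a, 'm) tvec \<Rightarrow> ('a, 'm) tvec"
    and x :: 'a
    and e :: "nat \<Rightarrow> ('a, 'm) tvec"
    and Ss Hs :: "real mat list"
  assumes "CARD('m) = 2 * n" and "2 * n \<ge> 4" and "CARD('k) = 2 * n + 1"
    and "smooth_manifold M A" and "connected_space M" and "orientable M A"
    and "immersion M A f" and "transversal_field M A f \<xi>"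
    and "induced_by M A f \<xi> nab h S \<tau>"
    and "curvature_of M A nab R"
    and "\<forall>y\<in>topspace M. nondegenerate_at A y (h y)"
    and "closed_one_form M A \<tau>"
    and "almost_symplectic M A \<omega>"
    and "p \<ge> 1"
    and "tensor_vanishes M A (2 * p + 2) ((curvature_action R ^^ p) (form_tensor \<omega>))"
    and "x \<in> topspace M"
    and "simultaneous_jordan_decomposition (tangent_space A x) (2 * n) (S x) (h x) e q r Ss Hs"
  shows "r = 0"
proof -
  interpret affine_hypersurface M A f \<xi> nab h S \<tau>
    using assms unfolding smooth_manifold_def by unfold_locales blast+
  have "bilinear_at A x (\<omega> x)" "\<And>u. u \<in> tangent_space A x \<Longrightarrow> \<omega> x u u = 0" "nondegenerate_at A x (\<omega> x)"
    using assms(13,16) unfolding almost_symplectic_def two_form_def by blast+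
  then show ?thesis
    using no_complex_jordan_block[of R x \<omega> p "2 * n" e q r Ss Hs] assms(2,10,11,14,15,16,17)
    unfolding tensor_vanishes_def by simp
qed

end
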